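(* With $w_m$ and $\kappa_r$ as defined in the context, $$\bigl((2m)!\bigr)^2w_m\in\mathbb Z_2^\times\qquad\text{for every }m\ge0;$$ equivalently, $$\nu_2\bigl([A^1B^0]\kappa_r\bigr)=-\bigl(3r-1+\nu_2((r-1)!)\bigr)\qquad\text{for every }r\ge1.$$
   Context: For $\nu$ and $k\ge0$ let $a_k(\nu)=\dfrac{\prod_{j=0}^{k-1}(4\nu^2-(2j+1)^2)}{8^k k!}$. Let $p=1+i$, $q=1-i$. For parameters $\alpha,\beta$ put $A=\alpha^2$, $B=\beta^2$, $G_n=\sum_{l=0}^n a_l(\alpha)a_{n-l}(\beta)p^lq^{n-l}$ and $F(Z)=\sum_{n\ge0}\dfrac{G_n}{(Z-1)(Z-2)\cdots(Z-n)}$, a formal power series in $Z^{-1}$ (each summand expanded at $Z=\infty$) with constant term $1$. Write $\log F=\sum_{n\ge1}L_nZ^{-n}$; each $L_n$ is a polynomial in $A,B$ with coefficients in $\mathbb Q(i)$. Phase constants (normalisation used here): $\kappa_r=2^{-(2r-1)}\operatorname{Im}L_{2r-1}$, a polynomial in $A,B$ over $\mathbb Q$, the imaginary part being taken on coefficients of monomials $A^iB^j$; $[A^1B^0]$ denotes extraction of the coefficient of the monomial $A$. Tangent: $g_n=\partial_AL_n|_{A=B=0}$, $\Phi(t)=\sum_{n\ge1}g_n\dfrac{t^n}{(n-1)!}$. The formal series $W(t)$ with rational coefficients is defined by $\dfrac{\sinh(2t)\,\Phi(t)}{t^2}=e^t+iW(t)$ (so $W(t)=\frac{\sinh 2t}{t^2}\operatorname{Im}\Phi(t)$,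 imaginary part coefficientwise); $W$ is even, and $w_m=[t^{2m}]W(t)$. $\nu_2$ is the $2$-adic valuation on $\mathbb Q$ and $\mathbb Z_2^\times$ the group of $2$-adic units. *)

theory Defs
  imports "HOL-Computational_Algebra.Computational_Algebra"
begin

datatype gauss_rat = GRat (re: rat) (im: rat)

lemma gauss_rat_eq_iff: "x = y \<longleftrightarrow> re x = re y \<and> im x = im y"
  by (cases x; cases y) simp

instantiation gauss_rat :: field
begin

definition zero_gauss_rat where "0 = GRat 0 0"
definition one_gauss_rat where "1 = GRat 1 0"
definition plus_gauss_rat where "x + y = GRat (re x + re y) (im x + im y)"
definition uminus_gauss_rat where "- x = GRat (- re x) (- im x)"
definition minus_gauss_rat where "x - y = GRat (re x - re y) (im x - im y)"
definition times_gauss_rat where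
  "x * y = GRat (re x * re y - im x * im y) (re x * im y + im x * re y)"
definition inverse_gauss_rat where
  "inverse x = GRat (re x / ((re x)\<^sup>2 + (im x)\<^sup>2)) (- im x / ((re x)\<^sup>2 + (im x)\<^sup>2))"
definition divide_gauss_rat where "x div y = x * inverse (y :: gauss_rat)"

lemmas gauss_rat_defs = zero_gauss_rat_def one_gauss_rat_def plus_gauss_rat_def
  uminus_gauss_rat_def minus_gauss_rat_def times_gauss_rat_def inverse_gauss_rat_def
  divide_gauss_rat_def

instance
proof
  fix x :: gauss_rat
  assume "x \<noteq> 0"
  then have "(re x)\<^sup>2 + (im x)\<^sup>2 \<noteq> 0"
    by (simp add: gauss_rat_eq_iff gauss_rat_defs sum_power2_eq_zero_iff)
  then show "inverse x * x = 1"
    by (simp add: gauss_rat_eq_iff gauss_rat_defs power2_eq_square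
        add_divide_distrib [symmetric] algebra_simps)
qed (simp_all add: gauss_rat_eq_iff gauss_rat_defs algebra_simps)

end

lemma re_im_of_nat [simp]: "re (of_nat n) = of_nat n" "im (of_nat n) = 0"
  by (induction n) (simp_all add: gauss_rat_defs)

instance gauss_rat :: field_char_0
proof
  show "inj (of_nat :: nat \<Rightarrow> gauss_rat)"
    by (rule injI) (metis of_nat_eq_iff re_im_of_nat(1))
qed

definition p_const :: gauss_rat where "p_const = GRat 1 1"
definition q_const :: gauss_rat where "q_const = GRat 1 (- 1)"


text \<open>
  \<open>gauss_rat poly poly\<close> represents $\mathbf{Q}(i)[A,B]$: the outer variable is $A$, the inner one
  is $B$, so that \<open>coeff (coeff P i) j\<close> is the coefficient of $A^i B^j$.
\<close>

definition const :: "gauss_rat \<Rightarrow> gauss_rat poly poly" where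
  "const c = [:[:c:]:]"

definition varA :: "gauss_rat poly poly" where "varA = [:0, 1:]"
definition varB :: "gauss_rat poly poly" where "varB = [:[:0, 1:]:]"

text \<open>
  The coefficient $a_k(\nu)$ depends on $\nu$ through $\nu^2$ only; the second argument of \<open>a_coef\<close>
  is $\nu^2$.
\<close>

definition a_coef :: "nat \<Rightarrow> gauss_rat poly poly \<Rightarrow> gauss_rat poly poly" where
  "a_coef k nusq = const (1 / (8 ^ k * fact k)) * (\<Prod>j<k. 4 * nusq - of_nat ((2 * j + 1) ^ 2))"

definition G_poly :: "nat \<Rightarrow> gauss_rat poly poly" where
  "G_poly n = (\<Sum>l\<le>n. a_coef l varA * a_coef (n - l) varB * const (p_const ^ l * q_const ^ (n - l)))"

text \<open>
  With \<open>fps_X\<close> $= Z^{-1}$, the expansion of $1 / ((Z-1)(Z-2)\cdots(Z-n))$ at $Z = \infty$ is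
  $X^n / ((1-X)(1-2X)\cdots(1-nX))$.
\<close>

definition inv_shifted_prod :: "nat \<Rightarrow> gauss_rat fps" where
  "inv_shifted_prod n = fps_X ^ n / (\<Prod>j=1..n. 1 - of_nat j * fps_X)"

text \<open>
  Since \<open>inv_shifted_prod n\<close> is divisible by \<open>fps_X ^ n\<close>, only the summands with \<open>n \<le> N\<close>
  contribute to the coefficient of \<open>fps_X ^ N\<close>.
\<close>

definition F_series :: "gauss_rat poly poly fps" where
  "F_series = Abs_fps (\<lambda>N. \<Sum>n\<le>N. G_poly n * const (inv_shifted_prod n $ N))"

text \<open>
  The library series \<open>fps_ln 1\<close> is $\log(1+X) = \sum_{k\ge1} (-1)^{k-1} X^k / k$. It requires
  coefficients in a field, so its coefficients are embedded into \<open>gauss_rat poly poly\<close>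
  before composing with $F - 1$.
\<close>

definition logF :: "gauss_rat poly poly fps" where
  "logF = Abs_fps (\<lambda>k. const (fps_ln 1 $ k)) oo (F_series - 1)"

definition L_coef :: "nat \<Rightarrow> gauss_rat poly poly" where
  "L_coef n = logF $ n"


definition kappa :: "nat \<Rightarrow> rat poly poly" where
  "kappa r = smult [:1 / 2 ^ (2 * r - 1):] (map_poly (map_poly im) (L_coef (2 * r - 1)))"

definition g_coef :: "nat \<Rightarrow> gauss_rat" where
  "g_coef n = poly (poly (pderiv (L_coef n)) 0) 0"

definition Phi :: "gauss_rat fps" where
  "Phi = Abs_fps (\<lambda>n. if n = 0 then 0 else g_coef n / fact (n - 1))"

definition sinh2 :: "rat fps" where
  "sinh2 = fps_const (1 / 2) * (fps_exp 2 - fps_exp (- 2))"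

text \<open>
  This is the imaginary part of the equation $\sinh(2t)\Phi(t)/t^2 = e^t + iW(t)$. The division
  is exact, as both \<open>sinh2\<close> and \<open>Phi\<close> have zero constant term.
\<close>

definition W_series :: "rat fps" where
  "W_series = sinh2 * Abs_fps (\<lambda>n. im (Phi $ n)) / fps_X ^ 2"

definition w_coef :: "nat \<Rightarrow> rat" where
  "w_coef m = W_series $ (2 * m)"


text \<open>
  The value at \<open>0\<close> is \<open>0\<close> by convention here, not $\infty$; nonvanishing is therefore stated
  separately where it matters.
\<close>

definition val2 :: "rat \<Rightarrow> int" where
  "val2 x = (case quotient_of x of (n, d) \<Rightarrow> int (multiplicity 2 n) - int (multiplicity 2 d))"

text \<open>The rational numbers that are units of the ring of 2-adic integers.\<close>

definition units2 :: "rat set" where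
  "units2 = {x. x \<noteq> 0 \<and> val2 x = 0}"

end

theory Submission
  imports Defs
begin

text \<open>
  Write \<open>X = 1/Z\<close>. The series \<open>\<Sum> a_k(\<nu>) x^(-k)\<close> is the Hankel expansion of the Bessel function
  \<open>K_\<nu>(x)\<close>, and \<open>1/((Z-1)...(Z-n)) = \<Gamma>(Z-n)/\<Gamma>(Z)\<close>. As \<open>1/p + 1/q = 1\<close>, the series \<open>F(Z)\<close> is, up to a
  constant, the asymptotic expansion of \<open>1/\<Gamma>(Z)\<close> times the Mellin integral of
  \<open>x^Z K_\<alpha>(x/p) K_\<beta>(x/q)\<close>. The differential equations of the two Bessel functions therefore give
  difference equations for \<open>F\<close> in \<open>Z\<close>. The choice of \<open>p\<close> and \<open>q\<close> enters through
  \<open>(1/p)^2 + (1/q)^2 = 0\<close>, which makes these equations short.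

  Only the terms of order 0 and 1 in \<open>A\<close>, at \<open>B = 0\<close>, matter. Call them \<open>F0\<close> and \<open>F1\<close>; then \<open>g_n\<close> is
  the coefficient of \<open>X^n\<close> in \<open>R = F1/F0\<close>. The difference equations become (\<open>recurrence_0\<close>,
  \<open>R_difference\<close>)

    \<open>F0(Z+2) = (Z-1)^2 / (Z (Z-2)) F0(Z-2)\<close>,
    \<open>R(Z-2) - R(Z+2) = 2/(Z-1)^2 + 2 i \<chi>(Z)/(Z^2-1)\<close>, where \<open>\<chi>(Z) = F0(Z)/F0(Z+2)\<close>.

  The formal Borel transform \<open>Z^(-n-1) \<mapsto> t^n/n!\<close> turns \<open>R(Z-2) - R(Z+2)\<close> into
  \<open>2 sinh(2t) \<Phi>(t)/t\<close> and \<open>1/(Z-1)^2\<close> into \<open>t e^t\<close>. Hence \<open>t W(t)\<close> is the Borel transform of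
  \<open>\<chi>(Z)/(Z^2-1)\<close>, that is, \<open>(2m+1)! w_m\<close> is the sum of the coefficients of \<open>X^(2j)\<close> in \<open>\<chi>\<close>
  for \<open>j \<le> m\<close>.

  The first equation implies a linear one for \<open>\<chi>\<close>, whose only solution with constant term 1 is
  (\<open>chi_recurrence\<close>, \<open>symmetric_recurrence_unique\<close>, \<open>chi_explicit_recurrence\<close>)

    \<open>\<chi>(Z) = \<Sum>k. (-1)^k (1\<cdot>3\<cdots>(2k-1))^4 / (2k)! \<cdot> 1/((Z^2-2^2)(Z^2-4^2)...(Z^2-(2k)^2))\<close>.

  On the Borel side, \<open>\<chi>(Z)/Z\<close> corresponds to the hypergeometric function
  \<open>2F1(1/2, 1/2; 1; -sinh(t)^2)\<close>. In \<open>(2m)!\<close> times the coefficient of \<open>X^(2m)\<close>, the \<open>k\<close>-th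
  summand is an integer divisible by \<open>(2m)!/(2k)!\<close>, which is even for \<open>k < m\<close>, and the summand
  \<open>k = m\<close> is odd. So \<open>(2m)! [X^(2m)] \<chi>\<close> is an odd integer. For the same reason only the last
  summand of \<open>(2m+1) (2m)!^2 w_m = \<Sum>j\<le>m. (2m)!/(2j)! \<cdot> ((2j)! [X^(2j)] \<chi>)\<close> is odd, which is the
  first claim.

  For the second claim, the convolution \<open>W = (sinh(2t)/t) (Im \<Phi>(t)/t)\<close>, multiplied by \<open>(2m)!^2\<close>,
  expresses \<open>(2m)!^2 w_m\<close> as \<open>2 (2m)! Im g_(2m+1)\<close> plus earlier terms of this kind with even weights.
  By induction \<open>2 (2m)! Im g_(2m+1)\<close> is a 2-adic unit, and with \<open>r = m + 1\<close> the valuation of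
  \<open>Im g_(2r-1) / 2^(2r-1)\<close> follows from \<open>\<nu>_2((2m)!) = m + \<nu>_2(m!)\<close>.
\<close>

section \<open>Linear operators on formal power series\<close>

lemma fps_X_power_dvd_nth:
  "fps_X ^ n dvd f \<Longrightarrow> i < n \<Longrightarrow> f $ i = (0 :: 'a :: comm_ring_1)"
  by (auto simp: dvd_def fps_X_power_mult_nth)

text \<open>
  The analogue for formal series of checking an identity on monomials. Divisibility by \<open>X^n\<close> takes
  the place of continuity: it makes each coefficient of \<open>C f\<close> depend on finitely many
  coefficients of \<open>f\<close>.
\<close>

lemma fps_linear_operator_eq_0:
  fixes C :: "'a::comm_ring_1 fps \<Rightarrow> 'a fps"
  assumes add: "\<And>f g. C (f + g) = C f + C g"
    and monom: "\<And>c n. C (fps_const c * fps_X ^ n) = 0"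
    and causal: "\<And>n f. fps_X ^ n dvd C (fps_X ^ n * f)"
  shows "C f = 0"
proof (rule fps_ext)
  fix N
  have C0: "C 0 = 0"
    using add[of 0 0] by simp
  have poly: "C (\<Sum>n\<in>A. fps_const (f $ n) * fps_X ^ n) = 0" if "finite A" for A
    using that by (induction A) (simp_all add: C0 add monom)
  have split: "f = (\<Sum>n\<le>N. fps_const (f $ n) * fps_X ^ n) + fps_X ^ Suc N * fps_shift (Suc N) f"
    by (rule fps_ext)
      (auto simp: fps_sum_nth fps_X_power_mult_nth mult_delta_right not_le simp del: power_Suc)
  have "C f $ N = C (fps_X ^ Suc N * fps_shift (Suc N) f) $ N"
    by (subst split, subst add, subst poly) simp_all
  also have "\<dots> = 0"
    by (rule fps_X_power_dvd_nth[OF causal]) simp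
  finally show "C f $ N = 0 $ N" by simp
qed

text \<open>
  The infinite sum \<open>\<Sum>n. g_n b_n\<close>, for a sequence of series with \<open>X^n\<close> dividing \<open>b_n\<close>; the bound on
  \<open>n\<close> is then harmless.
\<close>

definition expand :: "(nat \<Rightarrow> 'a::comm_ring_1 fps) \<Rightarrow> 'a fps \<Rightarrow> 'a fps" where
  "expand b g = Abs_fps (\<lambda>N. \<Sum>n\<le>N. g $ n * b n $ N)"

lemma expand_add: "expand b (f + g) = expand b f + expand b g"
  by (rule fps_ext) (simp add: expand_def algebra_simps sum.distrib)

lemma expand_cmult: "expand b (fps_const c * f) = fps_const c * expand b f"
  by (rule fps_ext) (simp add: expand_def sum_distrib_left mult.assoc)

lemma expand_diff: "expand b (f - g) = expand b f - expand b g"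
  by (rule fps_ext) (simp add: expand_def algebra_simps sum_subtractf)

lemma expand_uminus: "expand b (- g) = - expand b g"
  by (rule fps_ext) (simp add: expand_def sum_negf)

lemma expand_X_power:
  assumes "fps_X ^ n dvd b n"
  shows "expand b (fps_X ^ n) = b n"
  by (rule fps_ext) (use fps_X_power_dvd_nth[OF assms] in \<open>auto simp: expand_def mult_delta_left not_le\<close>)

lemma fps_X_power_dvdI:
  assumes "\<And>i. i < n \<Longrightarrow> f $ i = (0 :: 'a :: comm_ring_1)"
  shows "fps_X ^ n dvd f"
proof
  show "f = fps_X ^ n * fps_shift n f"
    by (rule fps_ext) (simp add: fps_X_power_mult_nth assms)
qed

lemma expand_dvd: "fps_X ^ n dvd expand b (fps_X ^ n * f)"
  by (rule fps_X_power_dvdI) (auto simp: expand_def fps_X_power_mult_nth intro!: sum.neutral)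

text \<open>
  With \<open>X = 1/Z\<close> this is the expansion at infinity of \<open>f(Z + c)\<close>, because
  \<open>1/(Z + c) = X/(1 + c X)\<close>.
\<close>

definition translate :: "'a::field \<Rightarrow> 'a fps \<Rightarrow> 'a fps" where
  "translate c f = f oo (fps_X * inverse (1 + fps_const c * fps_X))"

lemma translate_const [simp]: "translate c (fps_const a) = fps_const a"
  and translate_1 [simp]: "translate c 1 = 1"
  and translate_0 [simp]: "translate c 0 = 0"
  and translate_numeral [simp]: "translate c (numeral w) = numeral w"
  and translate_add: "translate c (f + g) = translate c f + translate c g"
  and translate_diff: "translate c (f - g) = translate c f - translate c g"
  and translate_uminus: "translate c (- f) = - translate c f"
  and translate_mult: "translate c (f * g) = translate c f * translate c g"
  and translate_power: "translate c (f ^ n) = translate c f ^ n"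
  and translate_nth_0 [simp]: "translate c f $ 0 = f $ 0"
  and translate_X: "translate c fps_X = fps_X * inverse (1 + fps_const c * fps_X)"
  by (simp_all add: translate_def fps_compose_add_distrib fps_compose_sub_distrib
      fps_compose_uminus fps_compose_mult_distrib fps_compose_power)

lemmas translate_hom = translate_add translate_diff translate_uminus translate_mult translate_power

lemma linear_mult_inverse: "(1 + fps_const c * fps_X) * inverse (1 + fps_const c * fps_X) = (1 :: 'a :: field fps)"
  by (rule inverse_mult_eq_1') simp

lemma translate_zero: "translate 0 f = f"
  by (simp add: translate_def)

lemma translate_translate: "translate a (translate b f) = translate (a + b) (f :: 'a :: field fps)"
proof -
  let ?A = "1 + fps_const a * fps_X" and ?AB = "1 + fps_const (a + b) * fps_X"
  have a: "?A * inverse ?A = 1" and ab: "?AB * inverse ?AB = 1"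
    by (rule linear_mult_inverse)+
  have "?AB = ?A * (1 + fps_const b * (fps_X * inverse ?A))"
    using a by (simp add: algebra_simps flip: fps_const_add)
  then have "inverse ?AB = inverse ?A * inverse (1 + fps_const b * (fps_X * inverse ?A))"
    by (metis fps_inverse_mult)
  then have "fps_X * inverse (1 + fps_const b * fps_X) oo fps_X * inverse ?A = fps_X * inverse ?AB"
    by (simp add: fps_compose_mult_distrib fps_inverse_compose fps_compose_add_distrib mult.assoc)
  then show ?thesis
    by (simp add: translate_def flip: fps_compose_assoc)
qed

lemma translate_dvd: "fps_X ^ n dvd f \<Longrightarrow> fps_X ^ n dvd translate c f"
  by (auto simp: dvd_def translate_mult translate_power translate_X power_mult_distrib mult.assoc)

text \<open>
  Formal series have no periods: if \<open>X^n\<close> is the lowest power in \<open>f - f_0\<close>, then translation by \<open>c\<close>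
  changes the coefficient of \<open>X^(n+1)\<close> by \<open>-n c\<close> times the leading one.
\<close>

lemma translate_eq_imp_const:
  fixes f :: "'a :: field_char_0 fps"
  assumes "translate c f = f" "c \<noteq> 0"
  shows "f = fps_const (f $ 0)"
proof (rule ccontr)
  define g where "g = f - fps_const (f $ 0)"
  assume "f \<noteq> fps_const (f $ 0)"
  then have g0: "g \<noteq> 0" by (simp add: g_def)
  define n where "n = subdegree g"
  have n: "n > 0"
    using g0 by (auto simp: n_def g_def subdegree_eq_0_iff simp flip: neq0_conv)
  define h where "h = unit_factor g"
  define J where "J = inverse (1 + fps_const c * fps_X)"
  have g: "g = fps_X ^ n * h"
    unfolding n_def h_def by (metis fps_unit_factor_decompose')
  have h0: "h $ 0 \<noteq> 0"
    using g0 by (simp add: h_def)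
  have J: "(1 + fps_const c * fps_X) * J = 1"
    unfolding J_def by (rule linear_mult_inverse)
  have "translate c g = g"
    using assms(1) by (simp add: g_def translate_hom)
  then have "fps_X ^ n * (J ^ n * translate c h) = fps_X ^ n * h"
    by (simp add: g translate_hom translate_X J_def power_mult_distrib mult.assoc)
  then have "J ^ n * translate c h = h"
    by simp
  then have "(1 + fps_const c * fps_X) ^ n * h = ((1 + fps_const c * fps_X) * J) ^ n * translate c h"
    by (simp only: power_mult_distrib mult.assoc)
  then have e: "translate c h = (1 + fps_const c * fps_X) ^ n * h"
    by (simp only: J power_one mult_1)
  have "translate c h $ 1 = h $ 1"
    by (simp add: translate_def fps_compose_nth)
  moreover have "((1 + fps_const c * fps_X) ^ n) $ Suc 0 = of_nat n * c"
    by (induction n) (simp_all add: fps_mult_nth fps_power_zeroth algebra_simps)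
  then have "((1 + fps_const c * fps_X) ^ n * h) $ 1 = of_nat n * c * h $ 0 + h $ 1"
    by (simp add: fps_mult_nth fps_power_zeroth)
  ultimately have "of_nat n * c * h $ 0 = 0"
    using e by simp
  then show False
    using n assms(2) h0 by simp
qed

section \<open>The factorial transform\<close>

text \<open>
  Formally \<open>(1/\<Gamma>(Z)) \<integral> e^(-x) x^(Z-1) g(1/x) dx\<close>, taken over \<open>x > 0\<close>: the power \<open>x^(-n)\<close> goes to
  \<open>\<Gamma>(Z-n)/\<Gamma>(Z)\<close>. The properties below are those of this integral.
\<close>

abbreviation factorial_transform :: "gauss_rat fps \<Rightarrow> gauss_rat fps" where
  "factorial_transform \<equiv> expand inv_shifted_prod"

abbreviation step_back :: "gauss_rat fps \<Rightarrow> gauss_rat fps" where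
  "step_back \<equiv> translate (-1)"

lemma step_back_X: "(1 - fps_X) * step_back fps_X = fps_X"
proof -
  have "(1 - fps_X) * inverse (1 - fps_X) = (1 :: gauss_rat fps)"
    by (rule inverse_mult_eq_1') simp
  then show ?thesis
    by (simp add: translate_X mult.left_commute flip: fps_const_neg)
qed

lemma fps_eq_if_mult_unit_eq:
  fixes u :: "'a :: field fps"
  assumes "u $ 0 \<noteq> 0" "u * f = u * g"
  shows "f = g"
  using assms by auto

lemma inv_shifted_prod_0 [simp]: "inv_shifted_prod 0 = 1"
  by (simp add: inv_shifted_prod_def)

lemma prod_linear_nth_0: "(\<Prod>j=1..n. 1 - of_nat j * (fps_X :: gauss_rat fps)) $ 0 \<noteq> 0"
  by (induction n) (simp_all add: fps_mult_nth)

lemma inv_shifted_prod_Suc: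
  "(1 - of_nat (Suc n) * fps_X) * inv_shifted_prod (Suc n) = fps_X * inv_shifted_prod n"
proof -
  let ?P = "\<lambda>n. \<Prod>j=1..n. 1 - of_nat j * (fps_X :: gauss_rat fps)"
  note P0 = prod_linear_nth_0
  have I: "inv_shifted_prod n * ?P n = fps_X ^ n" for n
    unfolding inv_shifted_prod_def using P0[of n]
    by (simp add: fps_divide_unit mult.assoc inverse_mult_eq_1)
  show ?thesis
  proof (rule fps_eq_if_mult_unit_eq[OF P0[of n]])
    have "?P n * ((1 - of_nat (Suc n) * fps_X) * inv_shifted_prod (Suc n))
        = inv_shifted_prod (Suc n) * ?P (Suc n)"
      by (simp add: mult_ac del: of_nat_Suc)
    also have "\<dots> = fps_X * (inv_shifted_prod n * ?P n)"
      by (simp only: I power_Suc)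
    finally show "?P n * ((1 - of_nat (Suc n) * fps_X) * inv_shifted_prod (Suc n))
        = ?P n * (fps_X * inv_shifted_prod n)"
      by (simp add: mult_ac)
  qed
qed

lemma X_power_dvd_inv_shifted_prod: "fps_X ^ n dvd inv_shifted_prod n"
  unfolding inv_shifted_prod_def
  by (subst fps_divide_unit[OF prod_linear_nth_0]) simp

lemma step_back_inv_shifted_prod:
  "(1 - fps_X) * inv_shifted_prod (Suc n) = fps_X * step_back (inv_shifted_prod n)"
proof (induction n)
  case 0
  then show ?case using inv_shifted_prod_Suc[of 0] by simp
next
  case (Suc n)
  let ?I = inv_shifted_prod and ?m = "of_nat n :: gauss_rat fps"
  have 1: "(1 - (?m + 2) * fps_X) * ?I (Suc (Suc n)) = fps_X * ?I (Suc n)"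
    using inv_shifted_prod_Suc[of "Suc n"] by (simp add: add.commute)
  have "step_back ((1 - (?m + 1) * fps_X) * ?I (Suc n)) = step_back (fps_X * ?I n)"
    using inv_shifted_prod_Suc[of n] by (simp add: add.commute)
  then have "(1 - (?m + 1) * step_back fps_X) * step_back (?I (Suc n)) = step_back fps_X * step_back (?I n)"
    by (simp add: translate_hom flip: fps_of_nat)
  then have 2: "(1 - (?m + 2) * fps_X) * step_back (?I (Suc n)) = fps_X * step_back (?I n)"
    using step_back_X by algebra
  have "(1 - (?m + 2) * fps_X) * ((1 - fps_X) * ?I (Suc (Suc n)))
      = (1 - fps_X) * (fps_X * ?I (Suc n))"
    by (simp only: mult.left_commute[of "1 - (?m + 2) * fps_X"] 1)
  also have "\<dots> = fps_X * (fps_X * step_back (?I n))"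
    by (simp only: mult.left_commute[of "1 - fps_X"] Suc.IH)
  also have "\<dots> = (1 - (?m + 2) * fps_X) * (fps_X * step_back (?I (Suc n)))"
    by (simp only: mult.left_commute[of "1 - (?m + 2) * fps_X"] 2)
  finally show ?case
    by (rule fps_eq_if_mult_unit_eq[rotated]) simp
qed

lemma inv_shifted_prod_by_parts:
  "inv_shifted_prod n + of_nat n * inv_shifted_prod (Suc n) = step_back (inv_shifted_prod n)"
proof -
  let ?I = inv_shifted_prod and ?m = "of_nat n :: gauss_rat fps"
  have 1: "(1 - (?m + 1) * fps_X) * ?I (Suc n) = fps_X * ?I n"
    using inv_shifted_prod_Suc[of n] by (simp add: add.commute)
  have "fps_X * (?I n + ?m * ?I (Suc n)) = fps_X * step_back (?I n)"
    using 1 step_back_inv_shifted_prod[of n] by algebra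
  then show ?thesis by simp
qed

lemma factorial_transform_X_power: "factorial_transform (fps_X ^ n) = inv_shifted_prod n"
  by (rule expand_X_power) (rule X_power_dvd_inv_shifted_prod)

lemma expand_preserves_dvd: "fps_X ^ n dvd f \<Longrightarrow> fps_X ^ n dvd expand b f"
  by (auto simp: dvd_def[of _ f] expand_dvd)

text \<open>
  A factor \<open>1/x\<close> under the integral lowers \<open>Z\<close> by one, and \<open>\<Gamma>(Z) = (Z-1) \<Gamma>(Z-1)\<close>.
\<close>

lemma factorial_transform_X_mult:
  "(1 - fps_X) * factorial_transform (fps_X * g) = fps_X * step_back (factorial_transform g)"
proof -
  define C where "C g = (1 - fps_X) * factorial_transform (fps_X * g) - fps_X * step_back (factorial_transform g)" for g
  have "C g = 0"
  proof (rule fps_linear_operator_eq_0[of C])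
    show "C (f + g) = C f + C g" for f g
      by (simp add: C_def expand_add translate_hom algebra_simps)
    show "C (fps_const c * fps_X ^ n) = 0" for c n
    proof -
      have "C (fps_const c * fps_X ^ n) = fps_const c * ((1 - fps_X) * factorial_transform (fps_X ^ Suc n)
              - fps_X * step_back (factorial_transform (fps_X ^ n)))"
        by (simp add: C_def expand_cmult translate_hom right_diff_distrib
            mult.left_commute[of _ "fps_const c"])
      then show ?thesis
        by (simp add: factorial_transform_X_power step_back_inv_shifted_prod del: power_Suc)
    qed
    show "fps_X ^ n dvd C (fps_X ^ n * f)" for n f
      unfolding C_def
      by (intro dvd_diff dvd_mult[OF expand_preserves_dvd] dvd_mult[OF translate_dvd[OF expand_preserves_dvd]]
          dvd_mult dvd_triv_left)
  qed
  then show ?thesis by (simp add: C_def)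
qed

text \<open>
  If \<open>X\<close> stands for \<open>1/x\<close>, this is \<open>- d/dx\<close>.
\<close>

abbreviation theta :: "gauss_rat fps \<Rightarrow> gauss_rat fps" where
  "theta g \<equiv> fps_X\<^sup>2 * fps_deriv g"

lemma theta_X_power: "theta (fps_X ^ n) = of_nat n * fps_X ^ Suc n"
proof (induction n)
  case (Suc n)
  have "theta (fps_X ^ Suc n) = fps_X * theta (fps_X ^ n) + fps_X\<^sup>2 * fps_X ^ n"
    by (simp add: algebra_simps)
  then show ?case
    unfolding Suc.IH by (simp add: power2_eq_square algebra_simps)
qed simp

text \<open>
  Integration by parts: \<open>g - dg/dx\<close> against \<open>e^(-x) x^(Z-1)\<close> gives \<open>Z - 1\<close> times the integral of
  \<open>g\<close> against \<open>e^(-x) x^(Z-2)\<close>.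
\<close>

lemma factorial_transform_by_parts:
  "factorial_transform (g + theta g) = step_back (factorial_transform g)"
proof -
  define C where "C g = factorial_transform (g + theta g) - step_back (factorial_transform g)" for g
  have "C g = 0"
  proof (rule fps_linear_operator_eq_0[of C])
    show "C (f + g) = C f + C g" for f g
      by (simp add: C_def expand_add translate_hom algebra_simps)
    show "C (fps_const c * fps_X ^ n) = 0" for c n
    proof -
      have "C (fps_const c * fps_X ^ n) = fps_const c * (factorial_transform (fps_X ^ n)
           + factorial_transform (theta (fps_X ^ n)) - step_back (factorial_transform (fps_X ^ n)))"
        by (simp add: C_def expand_add expand_cmult translate_hom right_diff_distrib
              distrib_left mult.left_commute[of _ "fps_const c"])
      also have "\<dots> = 0"
        unfolding theta_X_power fps_of_nat[symmetric] expand_cmult factorial_transform_X_power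
        by (simp add: fps_of_nat inv_shifted_prod_by_parts)
      finally show ?thesis .
    qed
    show "fps_X ^ n dvd C (fps_X ^ n * f)" for n f
    proof -
      have "theta (fps_X ^ n * f) = fps_X ^ n * (of_nat n * fps_X * f + theta f)"
        using theta_X_power[of n] by (simp add: algebra_simps power2_eq_square)
      then show ?thesis
        unfolding C_def by (intro dvd_diff expand_preserves_dvd translate_dvd dvd_add) auto
    qed
  qed
  then show ?thesis by (simp add: C_def)
qed

lemma factorial_transform_X_square_mult:
  "(1 - fps_X) * (1 - 2 * fps_X) * factorial_transform (fps_X\<^sup>2 * g)
     = fps_X\<^sup>2 * step_back (step_back (factorial_transform g))"
proof -
  let ?T = factorial_transform
  have 1: "(1 - fps_X) * ?T (fps_X\<^sup>2 * g) = fps_X * step_back (?T (fps_X * g))"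
    using factorial_transform_X_mult[of "fps_X * g"] by (simp add: power2_eq_square mult.assoc)
  have "step_back ((1 - fps_X) * ?T (fps_X * g)) = step_back (fps_X * step_back (?T g))"
    by (simp add: factorial_transform_X_mult)
  then have 2: "(1 - step_back fps_X) * step_back (?T (fps_X * g)) = step_back fps_X * step_back (step_back (?T g))"
    by (simp add: translate_hom)
  then have 3: "(1 - 2 * fps_X) * step_back (?T (fps_X * g)) = fps_X * step_back (step_back (?T g))"
    using step_back_X by algebra
  show ?thesis using 1 3 by algebra
qed

section \<open>Bilinear combinations of solutions of two Bessel equations\<close>

lemma theta_add: "theta (f + g) = theta f + theta g"
  and theta_diff: "theta (f - g) = theta f - theta g"
  and theta_mult: "theta (f * g) = theta f * g + f * theta g"
  by (simp_all add: algebra_simps)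

text \<open>
  Here \<open>u, u'\<close> represent a function \<open>k\<close> and its derivative, both divided by
  \<open>e^(-P x) x^(-1/2)\<close>, where \<open>k'' + k'/x = P^2 k + f/x^2\<close> (with \<open>f\<close> in the same normalisation), and
  \<open>v, v'\<close> represent a solution of the homogeneous equation with \<open>Q\<close>. As \<open>P + Q = 1\<close>, the products
  carry the common factor \<open>e^(-x)/x\<close>; the left-hand sides have the form to which integration by
  parts under the factorial transform applies. As \<open>P^2 + Q^2 = 0\<close>, the derivative of the sum
  \<open>u' v + u v'\<close> does not involve \<open>P^2 u v\<close>.
\<close>

lemma bilinear_system:
  fixes u u' f v v' :: "gauss_rat fps"
  assumes half: "2 * half = 1" and PQ: "P + Q = 1" "Q\<^sup>2 = - P\<^sup>2"
    and u: "theta u = - P * u - half * fps_X * u - u'"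
    and u': "theta u' = - P * u' + half * fps_X * u' - P\<^sup>2 * u - fps_X\<^sup>2 * f"
    and v: "theta v = - Q * v - half * fps_X * v - v'"
    and v': "theta v' = - Q * v' + half * fps_X * v' - Q\<^sup>2 * v"
  shows "u * v + theta (u * v) = - (fps_X * (u * v)) - (u' * v + u * v')"
    and "(u' * v + u * v') + theta (u' * v + u * v') = - (2 * (u' * v')) - fps_X\<^sup>2 * (f * v)"
    and "(u' * v - u * v') + theta (u' * v - u * v') = - (2 * P\<^sup>2) * (u * v) - fps_X\<^sup>2 * (f * v)"
    and "u' * v' + theta (u' * v') = fps_X * (u' * v') + P\<^sup>2 * (u' * v - u * v') - fps_X\<^sup>2 * (f * v')"
  unfolding theta_add theta_diff theta_mult u u' v v' using half PQ by algebra+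

text \<open>
  The passage from the Bessel equation, written for the factor of \<open>e^(-P x) x^(-1/2)\<close>, to a
  first-order system.
\<close>

lemma first_order_form:
  assumes half: "2 * half = 1" and c: "fps_deriv half = 0" "fps_deriv P = 0"
    and ode: "2 * P * theta u + theta (theta u) + (half * fps_X)\<^sup>2 * u = fps_X\<^sup>2 * f"
    and u': "u' = - P * u - half * fps_X * u - theta u"
  shows "theta u' = - P * u' + half * fps_X * u' - P\<^sup>2 * u - fps_X\<^sup>2 * f"
proof -
  have "theta u' = - P * theta u - half * fps_X * theta u - half * fps_X\<^sup>2 * u - theta (theta u)"
    unfolding u' by (simp add: algebra_simps c del: fps_deriv_eq_0_iff)
  then show ?thesis using ode half unfolding u' by algebra
qed

section \<open>Recurrences in the spectral variable\<close>

lemma translate_2_X: "(1 + 2 * fps_X) * translate 2 fps_X = (fps_X :: gauss_rat fps)"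
  using linear_mult_inverse[of "2 :: gauss_rat"]
  by (simp add: translate_X numeral_fps_const[symmetric] mult.left_commute[of _ fps_X])

definition ii :: gauss_rat where "ii = GRat 0 1"

lemma ii_square: "fps_const ii * fps_const ii = -1"
  by (simp add: ii_def gauss_rat_defs flip: fps_const_1_eq_1)

text \<open>
  The system satisfied by the factorial transforms of the bilinear combinations above: \<open>e\<close> comes
  from the product of the two functions, \<open>s\<close> from its derivative, \<open>d\<close> from the difference
  \<open>u' v - u v'\<close> and \<open>w\<close> from \<open>u' v'\<close>. The letters with index 1 denote the terms linear in \<open>A\<close>.
  All denominators are cleared.
\<close>

locale mellin_system =
  fixes e s d w e1 s1 d1 w1 :: "gauss_rat fps"
  assumes e_nth_0: "e $ 0 = 1"
    and e: "step_back e = - (1 - fps_X) * s"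
    and s: "step_back s = - 2 * w"
    and d: "step_back d = fps_const ii * e"
    and w: "2 * (1 - 2 * fps_X) * step_back w = - (fps_const ii * (1 - fps_X) * d)"
    and e1: "step_back e1 = - (1 - fps_X) * s1"
    and s1: "(1 - fps_X) * (1 - 2 * fps_X) * (step_back s1 + 2 * w1) = - fps_X\<^sup>2 * step_back (step_back e)"
    and d1: "(1 - fps_X) * (1 - 2 * fps_X) * (step_back d1 - fps_const ii * e1) = - fps_X\<^sup>2 * step_back (step_back e)"
    and w1: "2 * (1 - 2 * fps_X)\<^sup>2 * step_back w1
           = - fps_const ii * (1 - fps_X) * (1 - 2 * fps_X) * d1 - fps_X\<^sup>2 * step_back (step_back (s - d))"
begin

abbreviation "I \<equiv> fps_const ii"
abbreviation "J \<equiv> step_back fps_X"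
abbreviation X :: "gauss_rat fps" where "X \<equiv> fps_X"

lemmas push = translate_hom translate_const translate_1 translate_numeral

text \<open>
  Translation by \<open>-1\<close> maps \<open>1 - k X\<close> to \<open>(1 - (k+1) X)/(1 - X)\<close>. In what follows every translated
  identity is multiplied by the power of \<open>1 - X\<close> that clears its denominators.
\<close>

lemma J: "(1 - X) * J = X"
  by (rule step_back_X)

lemma J1: "(1 - X) * (1 - J) = 1 - 2 * X"
  unfolding right_diff_distrib J by simp

lemma J2: "(1 - X) * (1 - 2 * J) = 1 - 3 * X"
  unfolding right_diff_distrib mult.left_commute[of "1 - X" 2] J by simp

lemma J3: "(1 - X) * (1 - 3 * J) = 1 - 4 * X"
  unfolding right_diff_distrib mult.left_commute[of "1 - X" 3] J by simp

lemma e2: "(1 - X) * step_back (step_back e) = 2 * (1 - 2 * X) * w"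
proof -
  have "step_back (step_back e) = step_back (- (1 - X) * s)"
    by (simp only: e)
  then have "step_back (step_back e) = - (1 - J) * step_back s"
    by (simp only: push)
  then show ?thesis using s J by algebra
qed

lemma e3: "(1 - 2 * X)\<^sup>2 * step_back (step_back (step_back e)) = - I * (1 - X) * (1 - 3 * X) * d"
proof -
  have "step_back ((1 - X) * step_back (step_back e)) = step_back (2 * (1 - 2 * X) * w)"
    by (simp only: e2)
  then have "(1 - J) * step_back (step_back (step_back e)) = 2 * (1 - 2 * J) * step_back w"
    by (simp only: push)
  then have "(1 - 2 * X) * step_back (step_back (step_back e)) = 2 * (1 - 3 * X) * step_back w"
    using J by algebra
  then show ?thesis using w by algebra
qed

text \<open>
  Eliminating \<open>s\<close>, \<open>w\<close> and \<open>d\<close> in turn goes once round the cycle of the four first-order relations;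
  this leaves a two-term recurrence for \<open>e\<close> with step 4.
\<close>

lemma recurrence_0:
  "(1 - 3 * X)\<^sup>2 * step_back (step_back (step_back (step_back e))) = (1 - 2 * X) * (1 - 4 * X) * e"
proof -
  let ?S4 = "step_back (step_back (step_back (step_back e)))"
  have "step_back ((1 - 2 * X)\<^sup>2 * step_back (step_back (step_back e)))
      = step_back (- I * (1 - X) * (1 - 3 * X) * d)"
    by (simp only: e3)
  then have "(1 - 2 * J)\<^sup>2 * ?S4 = - I * (1 - J) * (1 - 3 * J) * step_back d"
    by (simp only: push)
  then have "(1 - 2 * J)\<^sup>2 * ?S4 = (1 - J) * (1 - 3 * J) * e"
    using d ii_square by algebra
  then have "(1 - X)\<^sup>2 * ((1 - 2 * J)\<^sup>2 * ?S4) = (1 - X)\<^sup>2 * ((1 - J) * (1 - 3 * J) * e)"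
    by simp
  moreover have "(1 - X)\<^sup>2 * ((1 - 2 * J)\<^sup>2 * ?S4) = (1 - 3 * X)\<^sup>2 * ?S4"
    unfolding J2[symmetric] by (simp only: power_mult_distrib mult.assoc)
  moreover have "(1 - X)\<^sup>2 * ((1 - J) * (1 - 3 * J) * e) = (1 - 2 * X) * (1 - 4 * X) * e"
    unfolding J1[symmetric] J3[symmetric] by (simp only: power2_eq_square mult_ac)
  ultimately show ?thesis by metis
qed

lemma e1_2: "(1 - X)\<^sup>2 * step_back (step_back e1)
   = 2 * (1 - X) * (1 - 2 * X) * w1 + X\<^sup>2 * step_back (step_back e)"
proof -
  have "step_back (step_back e1) = step_back (- (1 - X) * s1)"
    by (simp only: e1)
  then have "step_back (step_back e1) = - (1 - J) * step_back s1"
    by (simp only: push)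
  then have "(1 - X) * step_back (step_back e1) = - (1 - 2 * X) * step_back s1"
    using J by algebra
  then show ?thesis using s1 by algebra
qed

lemma e1_3: "(1 - 2 * X) ^ 3 * step_back (step_back (step_back e1))
   = - I * (1 - X) * (1 - 2 * X) * (1 - 3 * X) * d1
     - (1 - 3 * X) * X\<^sup>2 * step_back (step_back (s - d))
     + (1 - 2 * X) * X\<^sup>2 * step_back (step_back (step_back e))"
proof -
  let ?E1 = "step_back (step_back (step_back e1))" and ?E = "step_back (step_back (step_back e))"
  have "step_back ((1 - X)\<^sup>2 * step_back (step_back e1))
      = step_back (2 * (1 - X) * (1 - 2 * X) * w1 + X\<^sup>2 * step_back (step_back e))"
    by (simp only: e1_2)
  then have eq: "(1 - J)\<^sup>2 * ?E1 = 2 * (1 - J) * (1 - 2 * J) * step_back w1 + J\<^sup>2 * ?E"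
    by (simp only: push)
  have "(1 - 2 * X)\<^sup>2 * ?E1 = (1 - X)\<^sup>2 * ((1 - J)\<^sup>2 * ?E1)"
    unfolding J1[symmetric] by (simp only: power_mult_distrib mult.assoc)
  also have "\<dots> = 2 * (1 - 2 * X) * (1 - 3 * X) * step_back w1 + X\<^sup>2 * ?E"
  proof -
    have "(1 - X)\<^sup>2 * (2 * (1 - J) * (1 - 2 * J) * step_back w1 + J\<^sup>2 * ?E)
        = 2 * ((1 - X) * (1 - J)) * ((1 - X) * (1 - 2 * J)) * step_back w1 + ((1 - X) * J)\<^sup>2 * ?E"
      by algebra
    then show ?thesis unfolding eq J1 J2 J .
  qed
  finally have "(1 - 2 * X) ^ 3 * ?E1
     = (1 - 3 * X) * (2 * (1 - 2 * X)\<^sup>2 * step_back w1) + (1 - 2 * X) * X\<^sup>2 * ?E"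
    by algebra
  then show ?thesis unfolding w1 by algebra
qed

text \<open>
  The same elimination one order higher in \<open>A\<close>: the homogeneous part is that of \<open>recurrence_0\<close>,
  and the inhomogeneous terms are translates of the zeroth order.
\<close>

lemma recurrence_1:
  "(1 - X) * (1 - 3 * X) ^ 3 * step_back (step_back (step_back (step_back e1)))
   = (1 - X) * (1 - 2 * X) * (1 - 3 * X) * (1 - 4 * X) * e1
     + 2 * I * X\<^sup>2 * (1 - 2 * X) * (1 - 4 * X) * step_back (step_back e)
     + 2 * (1 - X) * (1 - 3 * X) * X\<^sup>2 * step_back (step_back (step_back (step_back e)))"
proof -
  let ?E1 = "step_back (step_back (step_back (step_back e1)))"
  let ?E = "step_back (step_back (step_back (step_back e)))"
  let ?E2 = "step_back (step_back e)"
  let ?S3 = "step_back (step_back (step_back s))"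
  have "step_back (step_back (step_back d)) = I * ?E2"
    by (simp only: d push)
  moreover have "step_back ((1 - 2 * X) ^ 3 * step_back (step_back (step_back e1)))
      = step_back (- I * (1 - X) * (1 - 2 * X) * (1 - 3 * X) * d1
     - (1 - 3 * X) * X\<^sup>2 * step_back (step_back (s - d))
     + (1 - 2 * X) * X\<^sup>2 * step_back (step_back (step_back e)))"
    by (simp only: e1_3)
  ultimately have eq: "(1 - 2 * J) ^ 3 * ?E1 = - I * (1 - J) * (1 - 2 * J) * (1 - 3 * J) * step_back d1
       - (1 - 3 * J) * J\<^sup>2 * (?S3 - I * ?E2) + (1 - 2 * J) * J\<^sup>2 * ?E"
    by (simp only: push)
  have "(1 - 3 * X) ^ 3 * ?E1 = (1 - X) ^ 3 * ((1 - 2 * J) ^ 3 * ?E1)"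
    unfolding J2[symmetric] by (simp only: power_mult_distrib mult.assoc)
  also have "\<dots> = - I * ((1 - X) * (1 - J)) * ((1 - X) * (1 - 2 * J)) * ((1 - X) * (1 - 3 * J)) * step_back d1
       - ((1 - X) * (1 - 3 * J)) * ((1 - X) * J)\<^sup>2 * (?S3 - I * ?E2)
       + ((1 - X) * (1 - 2 * J)) * ((1 - X) * J)\<^sup>2 * ?E"
    unfolding eq by algebra
  also note J1
  also note J2
  also note J3
  also note J
  finally have main: "(1 - 3 * X) ^ 3 * ?E1
     = - I * (1 - 2 * X) * (1 - 3 * X) * (1 - 4 * X) * step_back d1
       - (1 - 4 * X) * X\<^sup>2 * (?S3 - I * ?E2) + (1 - 3 * X) * X\<^sup>2 * ?E" .
  have s3: "(1 - 3 * X) * ?E = - (1 - 4 * X) * ?S3"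
  proof -
    define J2 J3 where "J2 = step_back J" and "J3 = step_back J2"
    have j: "(1 - J) * J2 = J"
      using arg_cong[OF J, of step_back] unfolding push J2_def .
    have j': "(1 - J2) * J3 = J2"
      using arg_cong[OF j, of step_back] unfolding push J2_def[symmetric] J3_def .
    have "step_back (step_back (step_back (step_back e))) = step_back (step_back (step_back (- (1 - X) * s)))"
      by (simp only: e)
    then have "?E = - (1 - J3) * ?S3"
      by (simp only: push J2_def J3_def)
    moreover have j2: "(1 - 2 * X) * J2 = X"
      by (metis J J1 j mult.assoc)
    moreover have "(1 - 3 * X) * J3 = X"
    proof -
      have "(1 - 3 * X) * J3 = ((1 - 2 * X) - X) * J3" by algebra
      also have "\<dots> = (1 - 2 * X) * ((1 - J2) * J3)"
        by (subst (2) j2[symmetric]) algebra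
      finally show ?thesis by (simp only: j' j2)
    qed
    ultimately show ?thesis by algebra
  qed
  show ?thesis
    using main s3 d1 ii_square recurrence_0 by algebra
qed

text \<open>
  The ratio \<open>e(Z)/e(Z+2)\<close> is the only way in which the zeroth order enters the difference equation
  for \<open>R\<close>.
\<close>

definition "\<chi> = e * inverse (translate 2 e)"
definition "R = e1 * inverse e"

abbreviation "K \<equiv> translate 2 X"

lemma K: "(1 + 2 * X) * K = X"
  by (rule translate_2_X)

lemma K1: "(1 + 2 * X) * (1 - K) = 1 + X"
  unfolding right_diff_distrib K by simp

lemma K2: "(1 + 2 * X) * (1 - 2 * K) = 1"
  unfolding right_diff_distrib mult.left_commute[of "1 + 2 * X" 2] K by simp

lemma K3: "(1 + 2 * X) * (1 - 3 * K) = 1 - X"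
  unfolding right_diff_distrib mult.left_commute[of "1 + 2 * X" 3] K by simp

lemma K4: "(1 + 2 * X) * (1 - 4 * K) = 1 - 2 * X"
  unfolding right_diff_distrib mult.left_commute[of "1 + 2 * X" 4] K by simp

lemma step_back_2: "step_back (step_back f) = translate (-2) f"
  by (simp add: translate_translate)

lemma step_back_4: "step_back (step_back (step_back (step_back f))) = translate (-2) (translate (-2) f)"
  by (simp only: step_back_2)

lemma translate_cancel [simp]: "translate 2 (translate (-2) f) = (f :: gauss_rat fps)"
  "translate (-2) (translate 2 f) = (f :: gauss_rat fps)"
  by (simp_all add: translate_translate translate_zero)

lemma e_ratio: "translate (-2) e = translate (-2) \<chi> * e"
proof -
  have "\<chi> * translate 2 e = e"
    unfolding \<chi>_def mult.assoc by (subst inverse_mult_eq_1) (simp_all add: e_nth_0)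
  then have "translate (-2) (\<chi> * translate 2 e) = translate (-2) e" by (simp only:)
  then show ?thesis by (simp add: translate_mult)
qed

lemma chi_nth_0: "\<chi> $ 0 = 1"
  by (simp add: \<chi>_def e_nth_0)

lemma e_neq_0: "e \<noteq> 0"
  using e_nth_0 by auto

lemma chi_translate_product: "(1 + X)\<^sup>2 * (\<chi> * translate 2 \<chi>) = 1 + 2 * X"
proof -
  define c where "c = translate (-2) \<chi>"
  define cc where "cc = translate (-2) c"
  have "translate (-2) (translate (-2) e) = cc * c * e"
    by (simp add: e_ratio translate_mult c_def cc_def)
  then have "e * ((1 - 3 * X)\<^sup>2 * (cc * c)) = e * ((1 - 2 * X) * (1 - 4 * X))"
    using recurrence_0 unfolding step_back_4 by (simp add: mult_ac)
  then have "(1 - 3 * X)\<^sup>2 * (cc * c) = (1 - 2 * X) * (1 - 4 * X)"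
    using e_neq_0 by simp
  then have "translate 2 ((1 - 3 * X)\<^sup>2 * (cc * c)) = translate 2 ((1 - 2 * X) * (1 - 4 * X))"
    by (simp only:)
  then have "(1 - 3 * K)\<^sup>2 * (c * \<chi>) = (1 - 2 * K) * (1 - 4 * K)"
    unfolding push by (simp add: cc_def c_def)
  then have "(1 + 2 * X)\<^sup>2 * ((1 - 3 * K)\<^sup>2 * (c * \<chi>)) = (1 + 2 * X)\<^sup>2 * ((1 - 2 * K) * (1 - 4 * K))"
    by (simp only:)
  then have "((1 + 2 * X) * (1 - 3 * K))\<^sup>2 * (c * \<chi>)
     = ((1 + 2 * X) * (1 - 2 * K)) * ((1 + 2 * X) * (1 - 4 * K))"
    by (simp only: power2_eq_square mult_ac)
  then have "(1 - X)\<^sup>2 * (c * \<chi>) = 1 - 2 * X"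
    unfolding K2 K3 K4 by simp
  then have "translate 2 ((1 - X)\<^sup>2 * (c * \<chi>)) = translate 2 (1 - 2 * X)"
    by (simp only:)
  then have "(1 - K)\<^sup>2 * (\<chi> * translate 2 \<chi>) = 1 - 2 * K"
    unfolding push by (simp add: c_def)
  then have "(1 + 2 * X)\<^sup>2 * ((1 - K)\<^sup>2 * (\<chi> * translate 2 \<chi>)) = (1 + 2 * X)\<^sup>2 * (1 - 2 * K)"
    by (simp only:)
  then have "((1 + 2 * X) * (1 - K))\<^sup>2 * (\<chi> * translate 2 \<chi>) = (1 + 2 * X) * ((1 + 2 * X) * (1 - 2 * K))"
    by (simp only: power2_eq_square mult_ac)
  then show ?thesis unfolding K1 K2 by simp
qed

lemma translate_neg_2_X: "(1 - 2 * X) * translate (-2) X = X"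
  using linear_mult_inverse[of "-2 :: gauss_rat"]
  by (simp add: translate_X numeral_fps_const[symmetric] mult.left_commute[of _ fps_X] flip: fps_const_neg)

lemma chi_translate_neg_product: "(1 - X)\<^sup>2 * (\<chi> * translate (-2) \<chi>) = 1 - 2 * X"
proof -
  let ?K = "translate (-2) X"
  have K1: "(1 - 2 * X) * (1 + ?K) = 1 - X"
    unfolding distrib_left translate_neg_2_X by simp
  have K2: "(1 - 2 * X) * (1 + 2 * ?K) = 1"
    unfolding distrib_left mult.left_commute[of "1 - 2 * X" 2] translate_neg_2_X by simp
  have "translate (-2) ((1 + X)\<^sup>2 * (\<chi> * translate 2 \<chi>)) = translate (-2) (1 + 2 * X)"
    by (simp only: chi_translate_product)
  then have "(1 + ?K)\<^sup>2 * (\<chi> * translate (-2) \<chi>) = 1 + 2 * ?K"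
    unfolding push by (simp add: mult.commute)
  then have "(1 - 2 * X)\<^sup>2 * ((1 + ?K)\<^sup>2 * (\<chi> * translate (-2) \<chi>)) = (1 - 2 * X)\<^sup>2 * (1 + 2 * ?K)"
    by (simp only:)
  then have "((1 - 2 * X) * (1 + ?K))\<^sup>2 * (\<chi> * translate (-2) \<chi>) = (1 - 2 * X) * ((1 - 2 * X) * (1 + 2 * ?K))"
    by (simp only: power2_eq_square mult_ac)
  then show ?thesis unfolding K1 K2 by simp
qed

text \<open>
  The recurrence for \<open>e\<close> determines \<open>\<chi>(Z) \<chi>(Z+2)\<close> and \<open>\<chi>(Z) \<chi>(Z-2)\<close> as rational functions. Their
  quotient gives a relation that is linear in \<open>\<chi>\<close>.
\<close>

lemma chi_recurrence:
  "(1 + X)\<^sup>2 * (1 - 2 * X) * translate 2 \<chi> = (1 - X)\<^sup>2 * (1 + 2 * X) * translate (-2) \<chi>"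
proof -
  have "\<chi> * ((1 + X)\<^sup>2 * (1 - 2 * X) * translate 2 \<chi>)
      = \<chi> * ((1 - X)\<^sup>2 * (1 + 2 * X) * translate (-2) \<chi>)"
    using chi_translate_product chi_translate_neg_product by algebra
  then show ?thesis
    using chi_nth_0 by auto
qed

text \<open>
  Variation of constants: dividing the inhomogeneous recurrence for \<open>e1\<close> by the solution \<open>e\<close> of the
  homogeneous one leaves a pure difference of \<open>R\<close>. The final translation by 2 makes the equation
  symmetric in the shifts.
\<close>

lemma R_difference:
  "(1 + X) * (1 - X)\<^sup>2 * (translate (-2) R - translate 2 R) = 2 * I * X\<^sup>2 * (1 - X) * \<chi> + 2 * (1 + X) * X\<^sup>2"
proof -
  define c where "c = translate (-2) \<chi>"
  \<comment> \<open>A fresh name, since \<open>R\<close> itself contains \<open>e1\<close>, which is rewritten to \<open>r * e\<close> below.\<close>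
  define r where "r = R"
  define S2 where "S2 = translate (-2) r"
  define S4 where "S4 = translate (-2) S2"
  have R: "e1 = r * e"
    unfolding r_def R_def mult.assoc by (subst inverse_mult_eq_1) (simp_all add: e_nth_0)
  define E where "E = translate (-2) (translate (-2) e)"
  have E1: "translate (-2) (translate (-2) e1) = S4 * E"
    by (simp add: R translate_mult S2_def S4_def E_def)
  have E2: "translate (-2) e = c * e"
    by (simp add: e_ratio c_def)
  have r0: "(1 - 3 * X)\<^sup>2 * E = (1 - 2 * X) * (1 - 4 * X) * e"
    using recurrence_0 unfolding step_back_4 E_def .
  have r1: "(1 - X) * (1 - 3 * X) ^ 3 * (S4 * E)
   = (1 - X) * (1 - 2 * X) * (1 - 3 * X) * (1 - 4 * X) * (r * e)
     + 2 * I * X\<^sup>2 * (1 - 2 * X) * (1 - 4 * X) * (c * e)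
     + 2 * (1 - X) * (1 - 3 * X) * X\<^sup>2 * E"
    using recurrence_1 unfolding step_back_4 step_back_2
    unfolding E1 E_def[symmetric] unfolding E2 unfolding R .
  have "(1 - 3 * X) * ((1 - X) * (1 - 3 * X) ^ 3 * (S4 * E))
     = (1 - X) * (1 - 3 * X)\<^sup>2 * S4 * ((1 - 3 * X)\<^sup>2 * E)"
    by algebra
  moreover have "(1 - 3 * X) * ((1 - X) * (1 - 2 * X) * (1 - 3 * X) * (1 - 4 * X) * (r * e)
     + 2 * I * X\<^sup>2 * (1 - 2 * X) * (1 - 4 * X) * (c * e)
     + 2 * (1 - X) * (1 - 3 * X) * X\<^sup>2 * E)
     = (1 - X) * (1 - 2 * X) * (1 - 3 * X)\<^sup>2 * (1 - 4 * X) * (r * e)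
     + 2 * I * X\<^sup>2 * (1 - 3 * X) * (1 - 2 * X) * (1 - 4 * X) * (c * e)
     + 2 * (1 - X) * X\<^sup>2 * ((1 - 3 * X)\<^sup>2 * E)"
    by algebra
  ultimately have "(1 - X) * (1 - 3 * X)\<^sup>2 * S4 * ((1 - 2 * X) * (1 - 4 * X) * e)
     = (1 - X) * (1 - 2 * X) * (1 - 3 * X)\<^sup>2 * (1 - 4 * X) * (r * e)
     + 2 * I * X\<^sup>2 * (1 - 3 * X) * (1 - 2 * X) * (1 - 4 * X) * (c * e)
     + 2 * (1 - X) * X\<^sup>2 * ((1 - 2 * X) * (1 - 4 * X) * e)"
    using r1 unfolding r0 by metis
  then have "((1 - 2 * X) * (1 - 4 * X) * e) * ((1 - X) * (1 - 3 * X)\<^sup>2 * (S4 - r))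
     = ((1 - 2 * X) * (1 - 4 * X) * e) * (2 * I * X\<^sup>2 * (1 - 3 * X) * c + 2 * (1 - X) * X\<^sup>2)"
    by algebra
  then have "(1 - X) * (1 - 3 * X)\<^sup>2 * (S4 - r) = 2 * I * X\<^sup>2 * (1 - 3 * X) * c + 2 * (1 - X) * X\<^sup>2"
    by (rule fps_eq_if_mult_unit_eq[rotated]) (simp add: e_nth_0)
  then have "translate 2 ((1 - X) * (1 - 3 * X)\<^sup>2 * (S4 - r))
     = translate 2 (2 * I * X\<^sup>2 * (1 - 3 * X) * c + 2 * (1 - X) * X\<^sup>2)"
    by (simp only:)
  then have eq: "(1 - K) * (1 - 3 * K)\<^sup>2 * (S2 - translate 2 r)
     = 2 * I * K\<^sup>2 * (1 - 3 * K) * \<chi> + 2 * (1 - K) * K\<^sup>2"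
    unfolding push by (simp add: S4_def c_def)
  have "u ^ 3 * (a * b\<^sup>2 * s) = (u * a) * (u * b)\<^sup>2 * s"
    "u ^ 3 * (2 * I * k\<^sup>2 * b * t + 2 * a * k\<^sup>2) = 2 * I * (u * k)\<^sup>2 * (u * b) * t + 2 * (u * a) * (u * k)\<^sup>2"
    for u a b k s t :: "gauss_rat fps"
    by algebra+
  from this(1)[of "1 + 2 * X" "1 - K" "1 - 3 * K"] this(2)[of "1 + 2 * X" K "1 - 3 * K" _ "1 - K"]
  show ?thesis
    using eq unfolding K1 K3 K S2_def r_def by metis
qed

end

section \<open>The Hankel expansions to first order\<close>

abbreviation coeff00 :: "gauss_rat poly poly \<Rightarrow> gauss_rat" where
  "coeff00 P \<equiv> coeff (coeff P 0) 0"

abbreviation coeff10 :: "gauss_rat poly poly \<Rightarrow> gauss_rat" where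
  "coeff10 P \<equiv> coeff (coeff P 1) 0"

lemma coeff00_mult: "coeff00 (P * Q) = coeff00 P * coeff00 Q"
  by (simp add: coeff_mult_0)

lemma coeff10_mult: "coeff10 (P * Q) = coeff00 P * coeff10 Q + coeff10 P * coeff00 Q"
  by (simp add: coeff_mult)

lemma const_coeff [simp]: "coeff00 (const c) = c" "coeff10 (const c) = 0"
  by (simp_all add: const_def)

lemma const_mult: "const (a * b) = const a * const b"
  by (simp add: const_def)

lemma a_coef_0: "a_coef 0 \<nu> = 1"
  by (simp add: a_coef_def const_def one_pCons)

lemma a_coef_Suc: "a_coef (Suc k) \<nu> =
    const (1 / (8 * of_nat (Suc k))) * ((4 * \<nu> - of_nat ((2 * k + 1)\<^sup>2)) * a_coef k \<nu>)"
proof -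
  have "const (1 / (8 ^ Suc k * fact (Suc k))) = const (1 / (8 * of_nat (Suc k))) * const (1 / (8 ^ k * fact k))"
    by (simp add: field_simps flip: const_mult)
  then show ?thesis
    by (simp add: a_coef_def mult_ac)
qed

lemma coeff_factor:
  "coeff00 (4 * varA - of_nat n) = - of_nat n" "coeff10 (4 * varA - of_nat n) = 4"
  "coeff00 (4 * varB - of_nat n) = - of_nat n" "coeff10 (4 * varB - of_nat n) = 0"
  by (simp_all add: varA_def varB_def numeral_poly of_nat_poly)

definition hankel0 :: "nat \<Rightarrow> gauss_rat" where "hankel0 k = coeff00 (a_coef k varA)"
definition hankel1 :: "nat \<Rightarrow> gauss_rat" where "hankel1 k = coeff10 (a_coef k varA)"

lemma hankel0_0 [simp]: "hankel0 0 = 1" and hankel1_0 [simp]: "hankel1 0 = 0"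
  by (simp_all add: hankel0_def hankel1_def a_coef_0)

lemma coeff_a_coef_varB: "coeff00 (a_coef k varB) = hankel0 k" "coeff10 (a_coef k varB) = 0"
proof -
  have "coeff00 (a_coef k varB) = hankel0 k \<and> coeff10 (a_coef k varB) = 0"
  proof (induction k)
    case (Suc k)
    then show ?case
      unfolding hankel0_def a_coef_Suc coeff00_mult coeff10_mult const_coeff coeff_factor by simp
  qed (simp add: hankel0_def a_coef_0)
  then show "coeff00 (a_coef k varB) = hankel0 k" "coeff10 (a_coef k varB) = 0" by auto
qed

lemma of_nat_odd_square: "of_nat ((2 * k + 1)\<^sup>2) = (2 * of_nat k + 1 :: gauss_rat)\<^sup>2"
  by (simp add: add.commute)

lemma hankel0_Suc: "8 * of_nat (Suc k) * hankel0 (Suc k) = - ((2 * of_nat k + 1)\<^sup>2) * hankel0 k"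
  unfolding hankel0_def a_coef_Suc coeff00_mult const_coeff coeff_factor of_nat_odd_square
  by (simp del: of_nat_Suc)

lemma hankel1_Suc: "8 * of_nat (Suc k) * hankel1 (Suc k)
    = 4 * hankel0 k - ((2 * of_nat k + 1)\<^sup>2) * hankel1 k"
  unfolding hankel0_def hankel1_def a_coef_Suc coeff10_mult coeff00_mult const_coeff coeff_factor of_nat_odd_square
  by (simp del: of_nat_Suc)

definition hankel_series :: "(nat \<Rightarrow> gauss_rat) \<Rightarrow> gauss_rat \<Rightarrow> gauss_rat fps" where
  "hankel_series a r = Abs_fps (\<lambda>k. a k * r ^ k)"

abbreviation half :: "gauss_rat fps" where "half \<equiv> fps_const (1 / 2)"

lemma theta_nth: "theta g $ Suc k = of_nat k * g $ k"
  and theta_nth_0: "theta g $ 0 = 0"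
  by (cases k) (simp_all add: fps_X_power_mult_nth del: of_nat_Suc)

text \<open>
  The recursion for the Hankel coefficients is Bessel's equation; the right-hand side \<open>f\<close> carries
  the coefficient of the preceding order in \<open>A\<close>.
\<close>

lemma hankel_series_ode:
  assumes rec: "\<And>k. 8 * of_nat (Suc k) * a (Suc k) = 4 * f k - (2 * of_nat k + 1)\<^sup>2 * a k"
    and P: "P * r = 1"
  shows "2 * fps_const P * theta (hankel_series a r) + theta (theta (hankel_series a r))
     + (half * fps_X)\<^sup>2 * hankel_series a r = fps_X\<^sup>2 * hankel_series f r" (is "?L = ?R")
proof (rule fps_ext)
  fix n
  let ?g = "hankel_series a r"
  have half2: "(half * fps_X)\<^sup>2 = fps_const (1 / 4) * fps_X\<^sup>2"
    by (simp add: power2_eq_square mult_ac flip: fps_const_mult)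
  have L: "?L = fps_const (2 * P) * theta ?g + theta (theta ?g) + fps_const (1 / 4) * (fps_X\<^sup>2 * ?g)"
    by (simp add: half2 mult.assoc flip: numeral_fps_const)
  consider "n = 0" | "n = 1" | k where "n = Suc (Suc k)"
    by (metis One_nat_def not0_implies_Suc)
  then show "?L $ n = ?R $ n"
  proof cases
    case 1
    then show ?thesis unfolding L by (simp add: theta_nth theta_nth_0 fps_X_power_mult_nth)
  next
    case 2
    then show ?thesis unfolding L by (simp add: theta_nth theta_nth_0 fps_X_power_mult_nth)
  next
    case 3
    have "?L $ n = 2 * P * (of_nat (Suc k) * (a (Suc k) * r ^ Suc k))
       + of_nat (Suc k) * (of_nat k * (a k * r ^ k)) + 1 / 4 * (a k * r ^ k)"
      unfolding L 3 fps_add_nth fps_mult_left_const_nth theta_nth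
      by (simp add: fps_X_power_mult_nth hankel_series_def)
    also have "\<dots> = r ^ k * ((P * r) * (8 * of_nat (Suc k) * a (Suc k)) + (2 * of_nat k + 1)\<^sup>2 * a k) / 4"
      by (simp add: field_simps power2_eq_square)
    also have "\<dots> = f k * r ^ k"
      unfolding P rec by simp
    finally show ?thesis
      by (simp add: 3 fps_X_power_mult_nth hankel_series_def)
  qed
qed

abbreviation U0 :: "gauss_rat fps" where "U0 \<equiv> hankel_series hankel0 p_const"
abbreviation U1 :: "gauss_rat fps" where "U1 \<equiv> hankel_series hankel1 p_const"
abbreviation V0 :: "gauss_rat fps" where "V0 \<equiv> hankel_series hankel0 q_const"

definition p_inv :: gauss_rat where "p_inv = GRat (1/2) (-1/2)"
definition q_inv :: gauss_rat where "q_inv = GRat (1/2) (1/2)"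

text \<open>
  The derivative of \<open>e^(-P x) x^(-1/2) u(1/x)\<close>, divided by \<open>e^(-P x) x^(-1/2)\<close>.
\<close>

abbreviation companion :: "gauss_rat \<Rightarrow> gauss_rat fps \<Rightarrow> gauss_rat fps" where
  "companion P u \<equiv> - fps_const P * u - half * fps_X * u - theta u"

lemma re_im_numeral [simp]: "re (numeral n) = numeral n" "im (numeral n) = 0"
  using re_im_of_nat[of "numeral n"] by simp_all

lemma p_q_inv: "p_inv * p_const = 1" "q_inv * q_const = 1" "p_inv + q_inv = 1" "q_inv\<^sup>2 = - p_inv\<^sup>2"
  "2 * p_inv\<^sup>2 = - ii"
  by (simp_all add: gauss_rat_eq_iff p_const_def q_const_def p_inv_def q_inv_def ii_def times_gauss_rat_def
      plus_gauss_rat_def uminus_gauss_rat_def one_gauss_rat_def power2_eq_square)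

lemma two_half: "2 * half = 1"
  by (simp add: numeral_fps_const)

lemma companion_system:
  assumes "\<And>k. 8 * of_nat (Suc k) * a (Suc k) = 4 * f k - (2 * of_nat k + 1)\<^sup>2 * a k" "P * r = 1"
  shows "theta (companion P (hankel_series a r)) = - fps_const P * companion P (hankel_series a r)
     + half * fps_X * companion P (hankel_series a r) - (fps_const P)\<^sup>2 * hankel_series a r
     - fps_X\<^sup>2 * hankel_series f r"
  by (rule first_order_form[OF two_half _ _ hankel_series_ode[OF assms] refl]) simp_all

text \<open>
  The two orders in \<open>A\<close> of the first Bessel factor, each multiplied by the second factor at \<open>\<beta> = 0\<close>.
  The order-0 factor acts as the inhomogeneity of order 1.
\<close>

lemma mellin_system_factorial_transforms:
  defines "s0 \<equiv> companion p_inv U0 * V0 + U0 * companion q_inv V0"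
    and "d0 \<equiv> companion p_inv U0 * V0 - U0 * companion q_inv V0"
    and "w0 \<equiv> companion p_inv U0 * companion q_inv V0"
    and "s1 \<equiv> companion p_inv U1 * V0 + U1 * companion q_inv V0"
    and "d1 \<equiv> companion p_inv U1 * V0 - U1 * companion q_inv V0"
    and "w1 \<equiv> companion p_inv U1 * companion q_inv V0"
  shows "mellin_system (factorial_transform (U0 * V0)) (factorial_transform s0) (factorial_transform d0)
     (factorial_transform w0) (factorial_transform (U1 * V0)) (factorial_transform s1)
     (factorial_transform d1) (factorial_transform w1)"
proof -
  let ?T = factorial_transform
  let ?I = "fps_const ii" and ?P = "fps_const p_inv" and ?Q = "fps_const q_inv"
  let ?v = "companion q_inv V0"
  have PQ: "?P + ?Q = 1" "?Q\<^sup>2 = - ?P\<^sup>2"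
    by (simp_all only: fps_const_add fps_const_power fps_const_neg p_q_inv fps_const_1_eq_1)
  have P2: "2 * ?P\<^sup>2 = - ?I"
    by (simp only: numeral_fps_const fps_const_power fps_const_mult fps_const_neg p_q_inv)
  have rec0: "8 * of_nat (Suc k) * hankel0 (Suc k) = 4 * 0 - (2 * of_nat k + 1)\<^sup>2 * hankel0 k" for k
    using hankel0_Suc[of k] by simp
  have zero: "hankel_series (\<lambda>_. 0) r = 0" for r
    by (rule fps_ext) (simp add: hankel_series_def)
  note u0 = companion_system[OF rec0 p_q_inv(1), unfolded zero]
  note u1 = companion_system[OF hankel1_Suc p_q_inv(1)]
  note v0 = companion_system[OF rec0 p_q_inv(2), unfolded zero, simplified mult_zero_right diff_zero]
  have comp: "theta u = - fps_const R * u - half * fps_X * u - companion R u" for u R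
    by simp
  note b0 = bilinear_system[OF two_half PQ comp u0 comp v0, folded s0_def d0_def w0_def]
  note b1 = bilinear_system[OF two_half PQ comp u1 comp v0, folded s1_def d1_def w1_def]
  have Tc: "?T (fps_const c * g) = fps_const c * ?T g" for c g
    by (rule expand_cmult)
  note lin = expand_add expand_diff expand_uminus
  have bk: "step_back (?T g) = ?T (g + theta g)" for g
    by (rule factorial_transform_by_parts[symmetric])
  have T2: "?T (2 * g) = 2 * ?T g" for g
    unfolding numeral_fps_const by (rule Tc)
  have TP: "2 * ?T (?P\<^sup>2 * g) = - ?I * ?T g" for g
    unfolding P2[symmetric] fps_const_power Tc by (simp add: mult.assoc)
  have TI: "?T (- (2 * ?P\<^sup>2) * g) = ?I * ?T g" for g
    unfolding P2 minus_minus by (rule Tc)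
  show ?thesis
  proof
    show "?T (U0 * V0) $ 0 = 1"
      by (simp add: expand_def hankel_series_def fps_mult_nth)
    show "step_back (?T (U0 * V0)) = - (1 - fps_X) * ?T s0"
    proof -
      have "step_back (?T (U0 * V0)) = - ?T (fps_X * (U0 * V0)) - ?T s0"
        unfolding bk b0 lin ..
      then show ?thesis using factorial_transform_X_mult[of "U0 * V0"] by algebra
    qed
    show "step_back (?T s0) = - 2 * ?T w0"
      unfolding bk b0 lin T2 by (simp add: expand_def fps_zero_def[symmetric])
    show "step_back (?T d0) = ?I * ?T (U0 * V0)"
      unfolding bk b0 lin TI by (simp add: expand_def fps_zero_def[symmetric])
    show "2 * (1 - 2 * fps_X) * step_back (?T w0) = - (?I * (1 - fps_X) * ?T d0)"
    proof -
      have "step_back (?T w0) = ?T (fps_X * w0) + ?T (?P\<^sup>2 * d0)"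
        unfolding bk b0 lin by (simp add: expand_def fps_zero_def[symmetric])
      then show ?thesis using factorial_transform_X_mult[of w0] TP[of d0] by algebra
    qed
    show "step_back (?T (U1 * V0)) = - (1 - fps_X) * ?T s1"
    proof -
      have "step_back (?T (U1 * V0)) = - ?T (fps_X * (U1 * V0)) - ?T s1"
        unfolding bk b1 lin ..
      then show ?thesis using factorial_transform_X_mult[of "U1 * V0"] by algebra
    qed
    note X2 = factorial_transform_X_square_mult[of "U0 * V0"]
    have "step_back (?T s1) = - 2 * ?T w1 - ?T (fps_X\<^sup>2 * (U0 * V0))"
      unfolding bk b1 lin T2 by simp
    then show "(1 - fps_X) * (1 - 2 * fps_X) * (step_back (?T s1) + 2 * ?T w1)
        = - fps_X\<^sup>2 * step_back (step_back (?T (U0 * V0)))"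
      using X2 by algebra
    have "step_back (?T d1) = ?I * ?T (U1 * V0) - ?T (fps_X\<^sup>2 * (U0 * V0))"
      unfolding bk b1 lin TI ..
    then show "(1 - fps_X) * (1 - 2 * fps_X) * (step_back (?T d1) - ?I * ?T (U1 * V0))
        = - fps_X\<^sup>2 * step_back (step_back (?T (U0 * V0)))"
      using X2 by algebra
    show "2 * (1 - 2 * fps_X)\<^sup>2 * step_back (?T w1) = - ?I * (1 - fps_X) * (1 - 2 * fps_X) * ?T d1
        - fps_X\<^sup>2 * step_back (step_back (?T s0 - ?T d0))"
    proof -
      have "2 * (U0 * ?v) = s0 - d0"
        by (simp add: s0_def d0_def)
      then have "2 * ?T (fps_X\<^sup>2 * (U0 * ?v)) = ?T (fps_X\<^sup>2 * (s0 - d0))"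
        by (simp only: T2[symmetric] mult.left_commute[of 2 "fps_X\<^sup>2"])
      moreover have "step_back (?T w1) = ?T (fps_X * w1) + ?T (?P\<^sup>2 * d1) - ?T (fps_X\<^sup>2 * (U0 * ?v))"
        unfolding bk b1 lin ..
      moreover have "2 * (1 - 2 * fps_X)\<^sup>2 * y = - ?I * (1 - fps_X) * (1 - 2 * fps_X) * d - fps_X\<^sup>2 * g"
        if "2 * c = z" "y = a + b - c" "(1 - fps_X) * a = fps_X * y" "2 * b = - ?I * d"
          "(1 - fps_X) * (1 - 2 * fps_X) * z = fps_X\<^sup>2 * g" for a b c d g y z :: "gauss_rat fps"
      proof -
        have "(1 - 2 * fps_X) * y = (1 - fps_X) * (b - c)"
          using that(2,3) by algebra
        then have "2 * (1 - 2 * fps_X)\<^sup>2 * y = (1 - fps_X) * (1 - 2 * fps_X) * (2 * b - 2 * c)"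
          by algebra
        then show ?thesis
          using that(5) unfolding that(1,4) by algebra
      qed
      ultimately show ?thesis
        using factorial_transform_X_mult[of w1] TP[of d1] factorial_transform_X_square_mult[of "s0 - d0"]
        unfolding lin by blast
    qed
  qed
qed

section \<open>The logarithm to first order\<close>

definition fps_coeff00 :: "gauss_rat poly poly fps \<Rightarrow> gauss_rat fps" where
  "fps_coeff00 f = Abs_fps (\<lambda>n. coeff00 (f $ n))"

definition fps_coeff10 :: "gauss_rat poly poly fps \<Rightarrow> gauss_rat fps" where
  "fps_coeff10 f = Abs_fps (\<lambda>n. coeff10 (f $ n))"

lemma fps_coeff00_mult: "fps_coeff00 (f * g) = fps_coeff00 f * fps_coeff00 g"
  by (rule fps_ext) (simp add: fps_coeff00_def fps_mult_nth coeff_sum coeff00_mult)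

lemma fps_coeff10_mult:
  "fps_coeff10 (f * g) = fps_coeff00 f * fps_coeff10 g + fps_coeff10 f * fps_coeff00 g"
  by (rule fps_ext)
    (simp add: fps_coeff00_def fps_coeff10_def fps_mult_nth coeff_sum coeff10_mult sum.distrib
      del: One_nat_def)

lemma fps_coeff_1: "fps_coeff00 1 = 1" "fps_coeff10 1 = 0"
  by (rule fps_ext, simp add: fps_coeff00_def fps_coeff10_def)+

lemma fps_coeff00_power: "fps_coeff00 (f ^ n) = fps_coeff00 f ^ n"
  by (induction n) (simp_all add: fps_coeff_1 fps_coeff00_mult)

lemma fps_coeff10_power_Suc:
  "fps_coeff10 (f ^ Suc n) = of_nat (Suc n) * (fps_coeff00 f ^ n * fps_coeff10 f)"
proof (induction n)
  case 0
  then show ?case by simp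
next
  case (Suc n)
  show ?case
    unfolding power_Suc[of f "Suc n"] fps_coeff10_mult Suc.IH fps_coeff00_power
    by (simp add: algebra_simps)
qed

text \<open>
  The derivative of \<open>log F\<close> with respect to \<open>A\<close> is \<open>F1/F0\<close>. Since \<open>coeff10\<close> is a derivation over
  \<open>coeff00\<close>, the chain rule can be checked term by term in the defining composition.
\<close>

lemma coeff10_log:
  assumes F0: "coeff00 (F $ 0) = 1" and F1: "coeff10 (F $ 0) = 0"
  shows "fps_coeff10 (Abs_fps (\<lambda>k. const (fps_ln 1 $ k)) oo (F - 1))
    = fps_coeff10 F * inverse (fps_coeff00 F)"
proof (rule fps_ext)
  fix n
  define L :: "gauss_rat fps" where "L = fps_ln 1"
  define H where "H = fps_coeff00 F - 1"
  have H: "fps_coeff00 (F - 1) = H"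
    by (rule fps_ext) (simp add: H_def fps_coeff00_def)
  have F': "fps_coeff10 (F - 1) = fps_coeff10 F"
    by (rule fps_ext) (simp add: fps_coeff10_def)
  have H0: "H $ 0 = 0"
    using F0 by (simp add: H_def fps_coeff00_def)
  have Hk: "H ^ k $ i = 0" if "i < k" for i k
    using startsby_zero_power_prefix[OF H0] that by blast
  have "fps_coeff10 (Abs_fps (\<lambda>k. const (L $ k)) oo (F - 1)) $ n
      = (\<Sum>k=0..n. L $ k * fps_coeff10 ((F - 1) ^ k) $ n)"
    by (simp add: fps_coeff10_def fps_compose_nth coeff_sum coeff10_mult del: One_nat_def)
  also have "\<dots> = (\<Sum>k=Suc 0..Suc n. L $ k * fps_coeff10 ((F - 1) ^ k) $ n)"
  proof -
    \<comment> \<open>The sum may be extended to \<open>k = n + 1\<close> because \<open>H\<close> and the \<open>A\<close>-linear part of \<open>F\<close> have no constant term.\<close>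
    have "(\<Sum>i=0..n. (H ^ n) $ i * fps_coeff10 F $ (n - i)) = 0"
    proof (rule sum.neutral, safe)
      fix i assume "i \<in> {0..n}"
      then show "(H ^ n) $ i * fps_coeff10 F $ (n - i) = 0"
        using Hk[of i n] F1 by (cases "i = n") (simp_all add: fps_coeff10_def)
    qed
    then have "fps_coeff10 ((F - 1) ^ Suc n) $ n = 0"
      unfolding fps_coeff10_power_Suc H F' by (simp add: fps_of_nat[symmetric] fps_mult_nth[of "H ^ n"] del: of_nat_Suc)
    moreover have "L $ 0 = 0" by (simp add: L_def)
    ultimately show ?thesis
      by (simp add: sum.atLeast_Suc_atMost[of 0 n] del: power_Suc)
  qed
  also have "\<dots> = (\<Sum>k=0..n. fps_deriv L $ k * (H ^ k * fps_coeff10 F) $ n)"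
    unfolding sum.shift_bounds_cl_Suc_ivl fps_coeff10_power_Suc H F' fps_of_nat[symmetric]
      fps_mult_left_const_nth
    by (simp add: mult_ac del: of_nat_Suc)
  also have "\<dots> = (\<Sum>k=0..n. \<Sum>i=0..n. fps_deriv L $ k * (H ^ k $ i * fps_coeff10 F $ (n - i)))"
    by (simp add: fps_mult_nth sum_distrib_left)
  also have "\<dots> = (\<Sum>i=0..n. (\<Sum>k=0..n. fps_deriv L $ k * H ^ k $ i) * fps_coeff10 F $ (n - i))"
    by (subst sum.swap) (simp add: sum_distrib_right mult.assoc)
  also have "\<dots> = (\<Sum>i=0..n. (fps_deriv L oo H) $ i * fps_coeff10 F $ (n - i))"
  proof (intro sum.cong refl arg_cong[of _ _ "\<lambda>x. x * _"])
    fix i assume "i \<in> {0..n}"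
    then show "(\<Sum>k=0..n. fps_deriv L $ k * H ^ k $ i) = (fps_deriv L oo H) $ i"
      unfolding fps_compose_nth by (intro sum.mono_neutral_right) (auto simp: Hk)
  qed
  also have "\<dots> = ((fps_deriv L oo H) * fps_coeff10 F) $ n"
    by (simp add: fps_mult_nth)
  also have "fps_deriv L oo H = inverse (fps_coeff00 F)"
    unfolding L_def fps_ln_deriv
    by (simp add: fps_inverse_compose H0 fps_compose_add_distrib) (simp add: H_def)
  finally show "fps_coeff10 (Abs_fps (\<lambda>k. const (fps_ln 1 $ k)) oo (F - 1)) $ n
      = (fps_coeff10 F * inverse (fps_coeff00 F)) $ n"
    by (simp add: L_def mult.commute)
qed

abbreviation F0 :: "gauss_rat fps" where "F0 \<equiv> factorial_transform (U0 * V0)"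
abbreviation F1 :: "gauss_rat fps" where "F1 \<equiv> factorial_transform (U1 * V0)"

lemma coeff_G_poly: "coeff00 (G_poly n) = (U0 * V0) $ n" "coeff10 (G_poly n) = (U1 * V0) $ n"
  unfolding G_poly_def coeff_sum coeff00_mult coeff10_mult const_coeff coeff_a_coef_varB
    fps_mult_nth atLeast0AtMost hankel_series_def fps_nth_Abs_fps hankel0_def[symmetric] hankel1_def[symmetric]
  by (simp_all add: mult_ac)

lemma fps_coeff_F_series: "fps_coeff00 F_series = F0" "fps_coeff10 F_series = F1"
  unfolding fps_coeff00_def fps_coeff10_def F_series_def expand_def fps_nth_Abs_fps coeff_sum
    coeff00_mult coeff10_mult const_coeff coeff_G_poly
  by simp_all

lemma F0_nth_0: "F0 $ 0 = 1" and F1_nth_0: "F1 $ 0 = 0"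
  by (simp_all add: expand_def hankel_series_def fps_mult_nth)

lemma coeff10_L_coef: "coeff10 (L_coef n) = (F1 * inverse F0) $ n"
proof -
  have "coeff00 (F_series $ 0) = 1" "coeff10 (F_series $ 0) = 0"
    using fps_coeff_F_series[THEN arg_cong, of "\<lambda>f. f $ 0"] F0_nth_0 F1_nth_0
    unfolding fps_coeff00_def fps_coeff10_def by simp_all
  from coeff10_log[OF this] show ?thesis
    unfolding L_coef_def logF_def fps_coeff_F_series by (simp add: fps_coeff10_def fps_eq_iff)
qed

lemma g_coef_eq: "g_coef n = (F1 * inverse F0) $ n"
  unfolding coeff10_L_coef[symmetric] by (simp add: g_coef_def poly_0_coeff_0 coeff_pderiv)

lemma coeff10_kappa: "coeff (coeff (kappa r) 1) 0 = im (g_coef (2 * r - 1)) / 2 ^ (2 * r - 1)"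
proof -
  have "im 0 = 0" by (simp add: zero_gauss_rat_def)
  then show ?thesis
    unfolding g_coef_eq coeff10_L_coef[symmetric]
    by (simp add: kappa_def coeff_map_poly)
qed

section \<open>An explicit factorial series for the ratio\<close>

text \<open>
  The expansion of \<open>1/((Z^2-2^2)(Z^2-4^2)...(Z^2-(2k)^2))\<close>.
\<close>

definition even_basis :: "nat \<Rightarrow> 'a::field fps" where
  "even_basis k = fps_X ^ (2 * k) * inverse (\<Prod>j=1..k. 1 - of_nat ((2 * j)\<^sup>2) * fps_X\<^sup>2)"

lemma even_basis_0 [simp]: "even_basis 0 = 1"
  by (simp add: even_basis_def)

lemma prod_even_nth_0: "(\<Prod>j=1..k. 1 - of_nat ((2 * j)\<^sup>2) * fps_X\<^sup>2 :: 'a :: field fps) $ 0 = 1"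
  by (induction k) (simp_all add: fps_mult_nth)

lemma even_basis_Suc:
  "(1 - of_nat ((2 * Suc k)\<^sup>2) * fps_X\<^sup>2) * even_basis (Suc k) = fps_X\<^sup>2 * (even_basis k :: 'a :: field fps)"
proof -
  let ?P = "\<lambda>k. \<Prod>j=1..k. 1 - of_nat ((2 * j)\<^sup>2) * fps_X\<^sup>2 :: 'a fps"
  have I: "?P k * even_basis k = fps_X ^ (2 * k)" for k
    unfolding even_basis_def
    by (subst mult.left_commute, subst inverse_mult_eq_1') (simp_all only: prod_even_nth_0, simp_all)
  have "?P k * ((1 - of_nat ((2 * Suc k)\<^sup>2) * fps_X\<^sup>2) * even_basis (Suc k)) = ?P (Suc k) * even_basis (Suc k)"
    by (simp only: prod.nat_ivl_Suc' le_add1 One_nat_def Suc_le_mono le0 mult_ac)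
  also have "\<dots> = ?P k * (fps_X\<^sup>2 * even_basis k)"
    unfolding mult.left_commute[of _ "fps_X\<^sup>2"] I by (simp flip: power_add)
  finally show ?thesis
    by (rule fps_eq_if_mult_unit_eq[rotated]) (simp only: prod_even_nth_0, simp)
qed

lemma even_basis_dvd: "fps_X ^ (2 * k) dvd even_basis k"
  by (simp add: even_basis_def)

lemma even_basis_X_power_dvd: "fps_X ^ k dvd even_basis k"
  using even_basis_dvd[of k] by (rule dvd_trans[rotated]) (simp add: le_imp_power_dvd)

text \<open>
  Up to a factor \<open>Z\<close>, the basis functions are reciprocals of products of \<open>Z + 2j\<close> for \<open>|j| \<le> k\<close>. A
  translation by \<open>2\<close> or \<open>-2\<close> moves this range by one, so that it stays within \<open>|j| \<le> k + 1\<close>.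
\<close>

lemma translate_even_basis:
  fixes c :: "'a :: field_char_0"
  assumes c: "c\<^sup>2 = 4"
  defines "C \<equiv> fps_const c"
  shows "fps_X\<^sup>2 * translate c (even_basis k) =
    (1 + C * fps_X) * (1 - C * of_nat k * fps_X) * (1 - C * (of_nat k + 1) * fps_X) * even_basis (Suc k)"
proof (induction k)
  case 0
  have "C\<^sup>2 = 4"
    using c by (simp add: C_def numeral_fps_const)
  then have "(1 + C * fps_X) * (1 - C * fps_X) = 1 - 4 * fps_X\<^sup>2"
    by (simp add: algebra_simps power2_eq_square)
  then show ?case
    using even_basis_Suc[of 0, where 'a = 'a] by simp
next
  case (Suc k)
  let ?X = "fps_X :: 'a fps" and ?m = "of_nat k :: 'a fps"
  let ?b = "even_basis :: nat \<Rightarrow> 'a fps"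
  define K where "K = translate c ?X"
  have C2: "C\<^sup>2 = 4"
    using c by (simp add: C_def numeral_fps_const)
  have K: "(1 + C * ?X) * K = ?X"
    unfolding K_def C_def translate_X by (metis linear_mult_inverse mult.left_commute mult.right_neutral)
  have b1: "(1 - (2 * (?m + 1))\<^sup>2 * ?X\<^sup>2) * ?b (Suc k) = ?X\<^sup>2 * ?b k"
    using even_basis_Suc[of k, where 'a = 'a] by (simp add: algebra_simps)
  have b2: "(1 - (2 * (?m + 2))\<^sup>2 * ?X\<^sup>2) * ?b (Suc (Suc k)) = ?X\<^sup>2 * ?b (Suc k)"
    using even_basis_Suc[of "Suc k", where 'a = 'a] by (simp add: algebra_simps)
  define T where "T = translate c (?b (Suc k))"
  have "translate c ((1 - (2 * (?m + 1))\<^sup>2 * ?X\<^sup>2) * ?b (Suc k)) = translate c (?X\<^sup>2 * ?b k)"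
    by (simp only: b1)
  then have "(1 - (2 * (?m + 1))\<^sup>2 * K\<^sup>2) * T = K\<^sup>2 * translate c (?b k)"
    by (simp add: translate_hom K_def T_def flip: fps_of_nat)
  then have "(1 + C * ?X)\<^sup>2 * ((1 - (2 * (?m + 1))\<^sup>2 * K\<^sup>2) * T) = (1 + C * ?X)\<^sup>2 * (K\<^sup>2 * translate c (?b k))"
    by (simp only:)
  moreover have "u\<^sup>2 * ((1 - a\<^sup>2 * K\<^sup>2) * T) = (u\<^sup>2 - a\<^sup>2 * (u * K)\<^sup>2) * T"
      "u\<^sup>2 * (K\<^sup>2 * v) = (u * K)\<^sup>2 * v" for u a v
    by algebra+
  ultimately have "((1 + C * ?X)\<^sup>2 - (2 * (?m + 1))\<^sup>2 * ?X\<^sup>2) * T = ?X\<^sup>2 * translate c (?b k)"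
    unfolding K by (metis K)
  then have "((1 + C * ?X)\<^sup>2 - (2 * (?m + 1))\<^sup>2 * ?X\<^sup>2) * T
     = (1 + C * ?X) * (1 - C * ?m * ?X) * (1 - C * (?m + 1) * ?X) * ?b (Suc k)"
    unfolding Suc.IH .
  then have "(1 - C * ?m * ?X) * ((1 + C * (?m + 2) * ?X) * T)
     = (1 - C * ?m * ?X) * ((1 + C * ?X) * (1 - C * (?m + 1) * ?X) * ?b (Suc k))"
    using C2 by algebra
  then have T: "(1 + C * (?m + 2) * ?X) * T = (1 + C * ?X) * (1 - C * (?m + 1) * ?X) * ?b (Suc k)"
    by (rule fps_eq_if_mult_unit_eq[rotated]) simp
  have "(1 + C * (?m + 2) * ?X) * (?X\<^sup>2 * T)
     = (1 + C * (?m + 2) * ?X) * ((1 + C * ?X) * (1 - C * (?m + 1) * ?X) * (1 - C * (?m + 2) * ?X) * ?b (Suc (Suc k)))"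
    using T b2 C2 by algebra
  then have "?X\<^sup>2 * T = (1 + C * ?X) * (1 - C * (?m + 1) * ?X) * (1 - C * (?m + 2) * ?X) * ?b (Suc (Suc k))"
    by (rule fps_eq_if_mult_unit_eq[rotated]) simp
  then show ?case
    by (simp add: T_def algebra_simps)
qed

text \<open>
  The difference operator that annihilates \<open>\<chi>\<close>, up to a fixed factor, acting on the coefficients
  of an expansion in \<open>even_basis\<close>; see \<open>expand_even_basis_recurrence\<close>.
\<close>

definition cubic_step :: "'a::field_char_0 fps \<Rightarrow> 'a fps" where
  "cubic_step g = Abs_fps (\<lambda>n. 8 * of_nat n * g $ n
     + (if n = 0 then 0 else 4 * (2 * of_nat n - 1) ^ 3 * g $ (n - 1)))"

text \<open>
  On a single basis function all terms are multiples of the next one, and what remains is a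
  polynomial identity. The sum over the basis telescopes into \<open>cubic_step\<close>.
\<close>

lemma expand_even_basis_recurrence:
  fixes g :: "'a::field_char_0 fps"
  shows "(1 - fps_X)\<^sup>2 * (1 + 2 * fps_X) * translate (-2) (expand even_basis g)
     - (1 + fps_X)\<^sup>2 * (1 - 2 * fps_X) * translate 2 (expand even_basis g)
     = fps_X * (1 - 4 * fps_X\<^sup>2) * expand even_basis (cubic_step g)"
proof -
  let ?X = "fps_X :: 'a fps"
  define C where "C g = (1 - ?X)\<^sup>2 * (1 + 2 * ?X) * translate (-2) (expand even_basis g)
     - (1 + ?X)\<^sup>2 * (1 - 2 * ?X) * translate 2 (expand even_basis g)
     - ?X * (1 - 4 * ?X\<^sup>2) * expand even_basis (cubic_step g)" for g
  have step_add: "cubic_step (f + g) = cubic_step f + cubic_step g" for f g :: "'a fps"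
    by (rule fps_ext) (simp add: cubic_step_def algebra_simps)
  have step_cmult: "cubic_step (fps_const c * f) = fps_const c * cubic_step f" for c and f :: "'a fps"
    by (rule fps_ext) (simp add: cubic_step_def algebra_simps)
  have basis: "expand even_basis (?X ^ n) = even_basis n" for n
    by (rule expand_X_power) (rule even_basis_X_power_dvd)
  have "C g = 0"
  proof (rule fps_linear_operator_eq_0[of C])
    show "C (f + g) = C f + C g" for f g
      by (simp add: C_def step_add expand_add translate_hom algebra_simps)
    show "C (fps_const c * ?X ^ k) = 0" for c k
    proof -
      let ?m = "of_nat k :: 'a fps" and ?b = "even_basis (Suc k) :: 'a fps"
      have "cubic_step (?X ^ k) = fps_const (8 * of_nat k) * ?X ^ k + fps_const (4 * (2 * of_nat k + 1) ^ 3) * ?X ^ Suc k"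
        by (rule fps_ext) (auto simp: cubic_step_def simp del: power_Suc)
      then have step: "expand even_basis (cubic_step (?X ^ k)) = 8 * ?m * even_basis k + 4 * (2 * ?m + 1) ^ 3 * ?b"
        by (simp only: expand_add expand_cmult basis numeral_fps_const fps_of_nat[symmetric]
            fps_const_1_eq_1[symmetric] fps_const_mult fps_const_add fps_const_power)
      have b: "(1 - (2 * (?m + 1))\<^sup>2 * ?X\<^sup>2) * ?b = ?X\<^sup>2 * even_basis k"
        using even_basis_Suc[of k, where 'a = 'a] by (simp add: algebra_simps)
      have p: "?X\<^sup>2 * translate 2 (even_basis k) =
         (1 + 2 * ?X) * (1 - 2 * ?m * ?X) * (1 - 2 * (?m + 1) * ?X) * ?b"
        using translate_even_basis[of "2 :: 'a" k] by (simp add: numeral_fps_const)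
      have m: "?X\<^sup>2 * translate (-2) (even_basis k) =
         (1 - 2 * ?X) * (1 + 2 * ?m * ?X) * (1 + 2 * (?m + 1) * ?X) * ?b"
        using translate_even_basis[of "-2 :: 'a" k] by (simp add: numeral_fps_const flip: fps_const_neg)
      \<comment> \<open>The factor \<open>X^2\<close> lets \<open>even_basis k\<close> be expressed by \<open>even_basis (Suc k)\<close>.\<close>
      have "?X\<^sup>2 * C (?X ^ k) = 0"
        unfolding C_def step basis using b p m by algebra
      then have "C (?X ^ k) = 0" by simp
      moreover have "C (fps_const c * ?X ^ k) = fps_const c * C (?X ^ k)"
        by (simp add: C_def expand_cmult step_cmult translate_hom right_diff_distrib
            mult.left_commute[of _ "fps_const c"])
      ultimately show ?thesis by simp
    qed
    show "?X ^ n dvd C (?X ^ n * f)" for n f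
    proof -
      have "?X ^ n dvd cubic_step (?X ^ n * f)"
        by (rule fps_X_power_dvdI) (auto simp: cubic_step_def fps_X_power_mult_nth)
      then show ?thesis
        unfolding C_def
        by (intro dvd_diff dvd_mult[OF expand_preserves_dvd] dvd_mult[OF translate_dvd[OF expand_preserves_dvd]]) simp_all
    qed
  qed
  then show ?thesis by (simp add: C_def)
qed

text \<open>
  The solution of the two-term recursion given by \<open>cubic_step\<close>; the product is \<open>1\<cdot>3\<cdots>(2k-1)\<close>.
\<close>

definition odd_coef :: "nat \<Rightarrow> 'a::field_char_0" where
  "odd_coef k = (-1) ^ k * (\<Prod>j<k. (2 * of_nat j + 1)) ^ 4 / fact (2 * k)"

lemma odd_coef_Suc: "8 * of_nat (Suc k) * odd_coef (Suc k) = - 4 * (2 * of_nat k + 1) ^ 3 * (odd_coef k :: 'a::field_char_0)"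
proof -
  define u v :: 'a where "u = 2 * of_nat k + 1" and "v = of_nat (Suc k)"
  have "u = of_nat (2 * k + 1)" by (simp add: u_def)
  then have nz: "u \<noteq> 0" "v \<noteq> 0" unfolding v_def by (simp_all only: of_nat_eq_0_iff)
  have f: "fact (2 * Suc k) = (2 * v) * (u * (fact (2 * k) :: 'a))"
    by (simp add: u_def v_def algebra_simps)
  show ?thesis
    unfolding odd_coef_def f prod.lessThan_Suc u_def[symmetric] v_def[symmetric] using nz
    by (simp add: field_simps power_mult_distrib power4_eq_xxxx power3_eq_cube)
qed

definition chi_explicit :: "'a::field_char_0 fps" where
  "chi_explicit = expand even_basis (Abs_fps odd_coef)"

lemma chi_explicit_recurrence:
  "(1 + fps_X)\<^sup>2 * (1 - 2 * fps_X) * translate 2 chi_explicit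
   = (1 - fps_X)\<^sup>2 * (1 + 2 * fps_X) * translate (-2) (chi_explicit :: 'a::field_char_0 fps)"
proof -
  have "cubic_step (Abs_fps odd_coef) = (0 :: 'a fps)"
  proof (rule fps_ext)
    fix n show "cubic_step (Abs_fps odd_coef) $ n = (0 :: 'a fps) $ n"
    proof (cases n)
      case (Suc k)
      have e: "2 * of_nat (Suc k) - 1 = (2 * of_nat k + 1 :: 'a)" by simp
      have "cubic_step (Abs_fps odd_coef) $ n
          = 8 * of_nat (Suc k) * odd_coef (Suc k) + 4 * (2 * of_nat (Suc k) - 1) ^ 3 * (odd_coef k :: 'a)"
        by (simp only: cubic_step_def Suc fps_nth_Abs_fps nat.simps diff_Suc_1 if_False)
      then show ?thesis
        unfolding e odd_coef_Suc by simp
    qed (simp add: cubic_step_def)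
  qed
  then show ?thesis
    using expand_even_basis_recurrence[of "Abs_fps odd_coef :: 'a fps"]
    by (simp add: chi_explicit_def expand_def fps_zero_def[symmetric])
qed

lemma chi_explicit_nth_0: "chi_explicit $ 0 = 1"
  by (simp add: chi_explicit_def expand_def odd_coef_def)

text \<open>
  The quotient of two solutions is invariant under translation by 4, hence constant.
\<close>

lemma symmetric_recurrence_unique:
  fixes f g :: "'a::field_char_0 fps"
  assumes f: "(1 + fps_X)\<^sup>2 * (1 - 2 * fps_X) * translate 2 f = (1 - fps_X)\<^sup>2 * (1 + 2 * fps_X) * translate (-2) f"
    and g: "(1 + fps_X)\<^sup>2 * (1 - 2 * fps_X) * translate 2 g = (1 - fps_X)\<^sup>2 * (1 + 2 * fps_X) * translate (-2) g"
    and 0: "f $ 0 = 1" "g $ 0 = 1"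
  shows "f = g"
proof -
  define q where "q = f * inverse g"
  have fq: "f = q * g"
    unfolding q_def mult.assoc by (subst inverse_mult_eq_1) (simp_all add: 0)
  let ?a = "(1 + fps_X)\<^sup>2 * (1 - 2 * fps_X) :: 'a fps" and ?b = "(1 - fps_X)\<^sup>2 * (1 + 2 * fps_X) :: 'a fps"
  have "(?a * translate 2 g) * translate 2 q = (?b * translate (-2) g) * translate (-2) q"
    using f unfolding fq translate_mult by (simp only: mult_ac)
  then have "(?a * translate 2 g) * translate 2 q = (?a * translate 2 g) * translate (-2) q"
    by (simp only: g)
  then have "translate 2 q = translate (-2) q"
    by (rule fps_eq_if_mult_unit_eq[rotated]) (simp add: 0 power2_eq_square)
  then have "translate 2 (translate 2 q) = translate 2 (translate (-2) q)"
    by (simp only:)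
  then have "translate 4 q = q"
    by (simp add: translate_translate translate_zero)
  then have "q = fps_const (q $ 0)"
    by (rule translate_eq_imp_const) simp
  also have "q $ 0 = 1"
    by (simp add: q_def 0)
  finally show ?thesis
    using fq by simp
qed

lemma fps_inverse_nth_Ints:
  fixes f :: "'a::field fps"
  assumes "\<And>n. f $ n \<in> \<int>" "f $ 0 = 1"
  shows "inverse f $ n \<in> \<int>"
proof (induction n rule: less_induct)
  case (less n)
  show ?case
  proof (cases n)
    case (Suc m)
    have "0 = (f * inverse f) $ n"
      using assms(2) by (simp add: inverse_mult_eq_1' Suc)
    also have "\<dots> = inverse f $ n + (\<Sum>i=1..n. f $ i * inverse f $ (n - i))"
      by (simp add: fps_mult_nth sum.atLeast_Suc_atMost assms(2))
    finally have "inverse f $ n = - (\<Sum>i=1..n. f $ i * inverse f $ (n - i))"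
      by (simp add: eq_neg_iff_add_eq_0)
    also have "\<dots> \<in> \<int>"
      by (intro Ints_minus Ints_sum Ints_mult assms(1) less.IH) auto
    finally show ?thesis .
  qed (simp add: assms(2))
qed

lemma even_basis_nth_Ints: "even_basis k $ n \<in> \<int>"
proof -
  have "(\<Prod>j=1..k. 1 - of_nat ((2 * j)\<^sup>2) * fps_X\<^sup>2 :: 'a fps) $ n \<in> \<int>" for n
  proof (induction k arbitrary: n)
    case (Suc k)
    have "(1 - of_nat m * fps_X\<^sup>2 :: 'a fps) $ i \<in> \<int>" for m i
      by (simp add: fps_one_nth flip: fps_of_nat)
    then show ?case
      using Suc by (simp add: prod.nat_ivl_Suc' fps_mult_nth Ints_sum Ints_mult del: of_nat_power of_nat_mult)
  qed (simp add: fps_one_nth)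
  from fps_inverse_nth_Ints[OF this prod_even_nth_0] show ?thesis
    unfolding even_basis_def fps_X_power_mult_nth by simp
qed

lemma even_basis_nth: "even_basis k $ (2 * k) = 1" "n < 2 * k \<Longrightarrow> even_basis k $ n = 0"
  unfolding even_basis_def fps_X_power_mult_nth by (simp_all only: diff_self_eq_0 fps_inverse_nth_0 prod_even_nth_0) simp_all

lemma even_fact_double_div:
  assumes "k < m"
  shows "even (fact (2 * m) div fact (2 * k) :: nat)"
proof -
  have "2 * fact (2 * k) dvd (fact (2 * m) :: nat)"
  proof -
    have "2 * fact (2 * k) dvd (fact (2 * Suc k) :: nat)"
    proof
      show "fact (2 * Suc k) = 2 * fact (2 * k) * ((k + 1) * (2 * k + 1) :: nat)"
        by (simp add: algebra_simps)
    qed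
    also have "\<dots> dvd fact (2 * m)"
      by (rule fact_dvd) (use assms in simp)
    finally show ?thesis .
  qed
  then obtain c where "fact (2 * m) = 2 * fact (2 * k) * (c::nat)" by (auto simp: dvd_def)
  then show ?thesis by (simp add: mult.assoc mult.left_commute[of 2])
qed

text \<open>
  In \<open>(2m)! [X^(2m)]\<close> the \<open>k\<close>-th summand is \<open>(2m)!/(2k)!\<close> times an odd number times a coefficient
  of a basis function, which is an integer, and equals 1 for \<open>k = m\<close>.
\<close>

lemma chi_explicit_nth:
  "\<exists>z::int. odd z \<and> fact (2 * m) * chi_explicit $ (2 * m) = (of_int z :: 'a::field_char_0)"
proof -
  define b where "b k = (SOME z. (even_basis k :: 'a fps) $ (2 * m) = of_int z)" for k
  have b: "(even_basis k :: 'a fps) $ (2 * m) = of_int (b k)" for k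
    unfolding b_def by (rule someI_ex) (metis even_basis_nth_Ints Ints_cases)
  have bm: "b m = 1"
    using b[of m] by (simp add: even_basis_nth)
  define u :: "nat \<Rightarrow> int" where "u k = (-1) ^ k * (\<Prod>j<k. (2 * int j + 1)) ^ 4" for k
  define d :: "nat \<Rightarrow> nat" where "d k = fact (2 * m) div fact (2 * k)" for k
  have d: "(fact (2 * m) :: 'a) / fact (2 * k) = of_nat (d k)" if "k \<le> m" for k
  proof -
    have "fact (2 * k) dvd (fact (2 * m) :: nat)"
      by (rule fact_dvd) (use that in simp)
    then obtain c where c: "fact (2 * m) = fact (2 * k) * (c :: nat)" by (auto simp: dvd_def)
    have "(fact (2 * m) :: 'a) = fact (2 * k) * of_nat c"
      by (metis c of_nat_fact of_nat_mult)
    then show ?thesis by (simp add: d_def c)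
  qed
  have d_even: "even (d k)" if "k < m" for k
    unfolding d_def using that by (rule even_fact_double_div)
  have u_odd: "odd (u k)" for k
    by (simp add: u_def) (induction k; simp)
  define z where "z = (\<Sum>k\<le>m. u k * int (d k) * b k)"
  have "fact (2 * m) * chi_explicit $ (2 * m)
      = (\<Sum>k\<le>2*m. fact (2 * m) * (odd_coef k * of_int (b k)) :: 'a)"
    by (simp add: chi_explicit_def expand_def b sum_distrib_left)
  also have "\<dots> = (\<Sum>k\<le>m. fact (2 * m) * (odd_coef k * of_int (b k)))"
  proof (rule sum.mono_neutral_right)
    have "b k = 0" if "m < k" for k
      using b[of k] that by (simp add: even_basis_nth)
    then show "\<forall>k\<in>{..2*m} - {..m}. fact (2 * m) * (odd_coef k * of_int (b k)) = (0::'a)"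
      by simp
  qed auto
  also have "\<dots> = of_int z"
  proof -
    have "fact (2 * m) * (odd_coef k * of_int (b k)) = (of_int (u k * int (d k) * b k) :: 'a)" if "k \<le> m" for k
      using d[OF that] by (simp add: odd_coef_def u_def field_simps)
    then show ?thesis unfolding z_def of_int_sum by (intro sum.cong) auto
  qed
  finally have "fact (2 * m) * chi_explicit $ (2 * m) = (of_int z :: 'a)" .
  moreover have "odd z"
  proof -
    have "z = (\<Sum>k<m. u k * int (d k) * b k) + u m * int (d m) * b m"
      by (simp add: z_def lessThan_Suc_atMost[symmetric])
    moreover have "even (\<Sum>k<m. u k * int (d k) * b k)"
      by (rule dvd_sum) (use d_even in auto)
    moreover have "odd (u m * int (d m) * b m)"
      using u_odd[of m] by (simp add: bm d_def)
    ultimately show ?thesis by simp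
  qed
  ultimately show ?thesis by blast
qed

section \<open>The formal Borel transform\<close>

text \<open>
  The formal inverse Laplace transform \<open>Z^(-n-1) \<mapsto> t^n/n!\<close>; the constant term is dropped.
\<close>

definition borel :: "'a::field_char_0 fps \<Rightarrow> 'a fps" where
  "borel f = Abs_fps (\<lambda>n. f $ Suc n / fact n)"

lemma borel_add: "borel (f + g) = borel f + borel g"
  by (rule fps_ext) (simp add: borel_def add_divide_distrib)

lemma borel_diff: "borel (f - g) = borel f - borel g"
  by (rule fps_ext) (simp add: borel_def diff_divide_distrib)

lemma borel_cmult: "borel (fps_const c * f) = fps_const c * borel f"
  by (rule fps_ext) (simp add: borel_def)

lemma translate_X_power_nth:
  fixes c :: "'a::field_char_0"
  shows "translate c (fps_X ^ Suc n) $ (Suc n + j) = (- c) ^ j * of_nat ((n + j) choose j)"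
proof -
  have "translate c (fps_X ^ Suc n) = fps_X ^ Suc n * inverse ((1 - fps_const (- c) * fps_X) ^ Suc n)"
  proof -
    have "1 + fps_const c * fps_X = 1 - fps_const (- c) * (fps_X :: 'a fps)"
      by (simp flip: fps_const_neg)
    then show ?thesis
      unfolding translate_power translate_X power_mult_distrib fps_inverse_power by (simp only:)
  qed
  also have "inverse ((1 - fps_const (- c) * fps_X) ^ Suc n)
      = Abs_fps (\<lambda>k. of_nat ((Suc n + k - 1) choose k) * (- c) ^ k)"
    by (rule one_minus_const_fps_X_neg_power') simp
  finally show ?thesis
    by (simp add: fps_X_power_mult_nth mult.commute del: power_Suc)
qed

text \<open>
  For a formal Laplace integral \<open>f(Z) = \<integral> e^(-Z t) b(t) dt\<close> a shift of \<open>Z\<close> by \<open>c\<close> multiplies \<open>b\<close> by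
  \<open>e^(-c t)\<close>. On monomials this is the binomial series for \<open>(1 + c X)^(-n)\<close>.
\<close>

lemma borel_translate:
  fixes f :: "'a::field_char_0 fps"
  shows "borel (translate c f) = fps_exp (- c) * borel f"
proof -
  define C where "C f = fps_X * (borel (translate c f) - fps_exp (- c) * borel f)" for f
  have dvd: "fps_X ^ n dvd fps_X * borel (fps_X ^ n * f)" for n and f :: "'a fps"
    by (rule fps_X_power_dvdI) (auto simp: fps_X_power_mult_nth borel_def)
  have dvd': "fps_X ^ n dvd f \<Longrightarrow> fps_X ^ n dvd fps_X * borel f" for n and f :: "'a fps"
    by (auto simp: dvd_def[of _ f] dvd)
  have monom: "borel (translate c (fps_X ^ n)) = fps_exp (- c) * borel (fps_X ^ n)" for n
  proof (cases n)
    case 0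
    have "borel 1 = (0 :: 'a fps)"
      by (rule fps_ext) (simp add: borel_def)
    then show ?thesis by (simp add: 0)
  next
    case (Suc k)
    have X: "borel (fps_X ^ Suc k) = fps_const (1 / fact k) * fps_X ^ k"
      by (rule fps_ext) (simp add: borel_def del: power_Suc)
    show ?thesis
    proof (rule fps_ext)
      fix i
      show "borel (translate c (fps_X ^ n)) $ i = (fps_exp (- c) * borel (fps_X ^ n)) $ i"
      proof (cases "i < k")
        case True
        have "fps_X ^ Suc k dvd translate c (fps_X ^ Suc k :: 'a fps)"
          by (rule translate_dvd) simp
        then have "translate c (fps_X ^ Suc k) $ Suc i = 0"
          by (rule fps_X_power_dvd_nth) (use True in simp)
        then show ?thesis
          using True unfolding Suc X
          by (simp add: borel_def mult.left_commute[of "fps_exp _"] fps_X_power_mult_right_nth del: power_Suc)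
      next
        case False
        then obtain j where i: "i = k + j" using le_Suc_ex by (metis not_less)
        have "borel (translate c (fps_X ^ Suc k)) $ i = (- c) ^ j * of_nat ((k + j) choose j) / fact (k + j)"
          using translate_X_power_nth[of c k j] by (simp add: borel_def i del: power_Suc)
        also have "\<dots> = (- c) ^ j / (fact j * fact k)"
          by (subst binomial_fact) (simp_all add: field_simps)
        also have "\<dots> = (fps_exp (- c) * borel (fps_X ^ Suc k)) $ i"
          unfolding X by (simp add: i mult.left_commute[of "fps_exp _"] fps_X_power_mult_right_nth)
        finally show ?thesis by (simp only: Suc)
      qed
    qed
  qed
  have "C f = 0"
  proof (rule fps_linear_operator_eq_0[of C])
    show "C (f + g) = C f + C g" for f g
      by (simp add: C_def translate_hom borel_add algebra_simps)
    show "C (fps_const a * fps_X ^ n) = 0" for a n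
      by (simp add: C_def translate_mult borel_cmult monom)
    show "fps_X ^ n dvd C (fps_X ^ n * f)" for n f
    proof -
      have "C (fps_X ^ n * f) = fps_X * borel (translate c (fps_X ^ n * f))
         - fps_exp (- c) * (fps_X * borel (fps_X ^ n * f))"
        by (simp add: C_def algebra_simps)
      then show ?thesis
        using dvd' translate_dvd by (metis dvd_diff dvd_mult dvd_triv_left)
    qed
  qed
  then show ?thesis by (simp add: C_def)
qed

section \<open>Odd fractions and the 2-adic valuation\<close>

lemma prime_elem_2_int: "prime_elem (2 :: int)"
  by (rule prime_imp_prime_elem) simp

lemma val2_divide:
  assumes "a \<noteq> 0" "b \<noteq> 0"
  shows "val2 (of_int a / of_int b) = int (multiplicity 2 a) - int (multiplicity 2 b)"
proof -
  obtain n d where q: "quotient_of (of_int a / of_int b) = (n, d)" by fastforce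
  have d: "d > 0" by (rule quotient_of_denom_pos[OF q])
  have "(of_int a / of_int b :: rat) = of_int n / of_int d"
    by (rule quotient_of_div[OF q])
  then have "(of_int (a * d) :: rat) = of_int (n * b)"
    using d assms by (simp add: field_simps)
  then have e: "a * d = n * b" by (simp only: of_int_eq_iff)
  then have "n \<noteq> 0" using d assms by auto
  then have "multiplicity 2 a + multiplicity 2 d = multiplicity 2 n + multiplicity 2 b"
    using d assms arg_cong[OF e, of "multiplicity 2"]
    by (simp add: prime_elem_multiplicity_mult_distrib[OF prime_elem_2_int])
  then show ?thesis
    by (simp add: val2_def q)
qed

lemma rat_eq_of_int_divide: 
  obtains a b :: int where "x = of_int a / (of_int b :: rat)" "b \<noteq> 0"
  by (metis quotient_of_div quotient_of_denom_pos surj_pair less_irrefl)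

lemma val2_mult:
  assumes "x \<noteq> 0" "y \<noteq> 0"
  shows "val2 (x * y) = val2 x + val2 y"
proof -
  obtain a b where x: "x = of_int a / of_int b" "b \<noteq> 0" by (rule rat_eq_of_int_divide)
  obtain c d where y: "y = of_int c / of_int d" "d \<noteq> 0" by (rule rat_eq_of_int_divide)
  have nz: "a \<noteq> 0" "c \<noteq> 0" using assms x y by auto
  have xy: "x * y = of_int (a * c) / of_int (b * d)" by (simp add: x y)
  have "a * c \<noteq> 0" "b * d \<noteq> 0" using nz x(2) y(2) by simp_all
  then have "val2 (x * y) = int (multiplicity 2 (a * c)) - int (multiplicity 2 (b * d))"
    unfolding xy by (rule val2_divide)
  then show ?thesis
    using nz x(2) y(2)
    by (simp add: x(1) y(1) val2_divide prime_elem_multiplicity_mult_distrib[OF prime_elem_2_int])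
qed

text \<open>
  The rational 2-adic units; their counterpart \<open>even_frac\<close> below describes the maximal ideal.
\<close>

definition odd_frac :: "rat \<Rightarrow> bool" where
  "odd_frac x \<longleftrightarrow> (\<exists>a b. odd a \<and> odd b \<and> x = of_int a / of_int b)"

definition even_frac :: "rat \<Rightarrow> bool" where
  "even_frac x \<longleftrightarrow> (\<exists>a b. even a \<and> odd b \<and> x = of_int a / of_int b)"

lemma odd_fracI: "odd a \<Longrightarrow> odd b \<Longrightarrow> odd_frac (of_int a / of_int b)"
  by (auto simp: odd_frac_def)

lemma odd_imp_nonzero_of_int: "odd b \<Longrightarrow> (of_int b :: rat) \<noteq> 0"
  by auto

lemma odd_frac_diff: "odd_frac x \<Longrightarrow> even_frac y \<Longrightarrow> odd_frac (x - y)"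
  unfolding odd_frac_def even_frac_def
proof safe
  fix a b c d :: int
  assume *: "odd a" "odd b" "even c" "odd d"
  then have "of_int a / of_int b - of_int c / of_int d = (of_int (a * d - c * b) / of_int (b * d) :: rat)"
    using odd_imp_nonzero_of_int[of b] odd_imp_nonzero_of_int[of d] by (simp add: field_simps)
  then show "\<exists>a' b'. odd a' \<and> odd b' \<and> of_int a / of_int b - of_int c / of_int d = (of_int a' / of_int b' :: rat)"
    using * by (intro exI[of _ "a * d - c * b"] exI[of _ "b * d"]) simp
qed

lemma even_frac_add: "even_frac x \<Longrightarrow> even_frac y \<Longrightarrow> even_frac (x + y)"
  unfolding even_frac_def
proof safe
  fix a b c d :: int
  assume *: "even a" "odd b" "even c" "odd d"
  then have "of_int a / of_int b + of_int c / of_int d = (of_int (a * d + c * b) / of_int (b * d) :: rat)"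
    using odd_imp_nonzero_of_int[of b] odd_imp_nonzero_of_int[of d] by (simp add: field_simps)
  then show "\<exists>a' b'. even a' \<and> odd b' \<and> of_int a / of_int b + of_int c / of_int d = (of_int a' / of_int b' :: rat)"
    using * by (intro exI[of _ "a * d + c * b"] exI[of _ "b * d"]) simp
qed

lemma even_frac_mult: "even_frac x \<Longrightarrow> odd_frac y \<Longrightarrow> even_frac (x * y)"
  unfolding odd_frac_def even_frac_def
proof safe
  fix a b c d :: int
  assume *: "even a" "odd b" "odd c" "odd d"
  then show "\<exists>a' b'. even a' \<and> odd b' \<and> of_int a / of_int b * (of_int c / of_int d) = (of_int a' / of_int b' :: rat)"
    by (intro exI[of _ "a * c"] exI[of _ "b * d"]) simp
qed

lemma even_frac_sum:
  assumes "\<And>k. k \<in> A \<Longrightarrow> even_frac (f k)"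
  shows "even_frac (sum f A)"
proof -
  have "even_frac 0" unfolding even_frac_def by (rule exI[of _ 0], rule exI[of _ 1]) simp
  then show ?thesis
    using assms by (induction A rule: infinite_finite_induct) (auto intro: even_frac_add)
qed

lemma odd_frac_val2: "odd_frac x \<Longrightarrow> x \<noteq> 0 \<and> val2 x = 0"
  unfolding odd_frac_def
proof (elim exE conjE)
  fix a b :: int assume *: "odd a" "odd b" "x = of_int a / of_int b"
  then have "a \<noteq> 0" "b \<noteq> 0" by auto
  with * show "x \<noteq> 0 \<and> val2 x = 0"
    by (simp add: val2_divide not_dvd_imp_multiplicity_0)
qed

lemma val2_2_power: "val2 (2 ^ n) = int n"
  using val2_divide[of "2 ^ n" 1] by simp

lemma val2_odd: "odd n \<Longrightarrow> val2 (of_nat n) = 0"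
  using odd_frac_val2[OF odd_fracI[of "int n" 1]] by simp

lemma val2_fact_double: "val2 (fact (2 * m)) = int m + val2 (fact m)"
proof (induction m)
  case (Suc m)
  have f: "fact (2 * Suc m) = (2 ^ 1 :: rat) * (of_nat (Suc m) * (of_nat (2 * m + 1) * fact (2 * m)))"
    by (simp add: algebra_simps)
  have g: "fact (Suc m) = of_nat (Suc m) * (fact m :: rat)" by simp
  have nz: "of_nat (Suc m) \<noteq> (0 :: rat)" "of_nat (2 * m + 1) \<noteq> (0 :: rat)"
    by (simp_all only: of_nat_eq_0_iff)
  have "val2 (fact (2 * Suc m)) = 1 + val2 (of_nat (Suc m)) + val2 (fact (2 * m))"
  proof -
    have "val2 (of_nat (2 * m + 1)) = 0" by (rule val2_odd) simp
    moreover have "val2 (2 ^ 1) = 1" by (simp only: val2_2_power of_nat_1)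
    moreover have "val2 (c * (a * (b * d))) = val2 c + (val2 a + (val2 b + val2 d))"
      if "a \<noteq> 0" "b \<noteq> 0" "c \<noteq> 0" "d \<noteq> 0" for a b c d
      using that by (simp add: val2_mult)
    note this[OF nz, of "2 ^ 1" "fact (2 * m)"]
    ultimately show ?thesis
      unfolding f by simp
  qed
  also have "\<dots> = int (Suc m) + val2 (fact (Suc m))"
    unfolding g using nz Suc.IH val2_mult[OF nz(1) fact_nonzero, of m] by (simp del: of_nat_Suc)
  finally show ?case .
qed simp

section \<open>The series W and its coefficients\<close>

lemma re_im_simps [simp]:
  "re 0 = 0" "im 0 = 0" "re (x + y) = re x + re y" "im (x + y) = im x + im y"
  "re (x - y) = re x - re y" "im (x - y) = im x - im y" "re (- x) = - re x" "im (- x) = - im x"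
  "re 1 = 1" "im 1 = 0"
  by (simp_all add: gauss_rat_defs)

lemma re_im_of_int [simp]: "re (of_int z) = of_int z" "im (of_int z) = 0"
  by (cases z; simp)+

lemma re_im_sum: "re (sum f A) = (\<Sum>x\<in>A. re (f x))" "im (sum f A) = (\<Sum>x\<in>A. im (f x))"
  by (induction A rule: infinite_finite_induct) simp_all

lemma re_im_mult_real: "im y = 0 \<Longrightarrow> re (y * x) = re y * re x" "im y = 0 \<Longrightarrow> im (y * x) = re y * im x"
  by (simp_all add: times_gauss_rat_def)

lemma re_im_of_int_quotient:
  assumes "of_nat n * y = of_int z" "n \<noteq> 0"
  shows "im y = 0" "re y = of_int z / of_nat n"
proof -
  have "of_nat n * re y = of_int z" "of_nat n * im y = 0"
    using re_im_mult_real[of "of_nat n" y] by (simp_all add: assms(1))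
  then show "im y = 0" "re y = of_int z / of_nat n"
    using assms(2) by (simp_all add: field_simps)
qed

lemma im_ii_mult: "im (ii * x) = re x"
  by (simp add: ii_def times_gauss_rat_def)

abbreviation L1 :: "gauss_rat fps" where "L1 \<equiv> F1 * inverse F0"

text \<open>
  The series \<open>chi_sum\<close> is \<open>\<chi>(Z)/(Z^2-1)\<close>; its coefficients are partial sums of those of \<open>\<chi>\<close>.
\<close>

lemma L1_difference:
  obtains chi_sum where "(1 - fps_X\<^sup>2) * chi_sum = fps_X\<^sup>2 * chi_explicit"
    "translate (-2) L1 - translate 2 L1
      = 2 * (fps_const ii * chi_sum + fps_X\<^sup>2 * inverse ((1 - fps_X)\<^sup>2))"
proof -
  from mellin_system_factorial_transforms interpret mellin_system F0 "factorial_transform (companion p_inv U0 * V0 + U0 * companion q_inv V0)"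
    "factorial_transform (companion p_inv U0 * V0 - U0 * companion q_inv V0)"
    "factorial_transform (companion p_inv U0 * companion q_inv V0)" F1
    "factorial_transform (companion p_inv U1 * V0 + U1 * companion q_inv V0)"
    "factorial_transform (companion p_inv U1 * V0 - U1 * companion q_inv V0)"
    "factorial_transform (companion p_inv U1 * companion q_inv V0)" .
  have chi: "\<chi> = chi_explicit"
    by (rule symmetric_recurrence_unique[OF chi_recurrence chi_explicit_recurrence
          chi_nth_0 chi_explicit_nth_0])
  define \<psi> where "\<psi> = fps_X\<^sup>2 * chi_explicit * inverse (1 - fps_X\<^sup>2 :: gauss_rat fps)"
  define \<eta> where "\<eta> = fps_X\<^sup>2 * inverse ((1 - fps_X)\<^sup>2 :: gauss_rat fps)"
  have psi: "(1 - fps_X\<^sup>2) * \<psi> = fps_X\<^sup>2 * chi_explicit"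
    unfolding \<psi>_def by (subst mult.left_commute, subst inverse_mult_eq_1') simp_all
  have eta: "(1 - fps_X)\<^sup>2 * \<eta> = fps_X\<^sup>2"
    unfolding \<eta>_def by (subst mult.left_commute, subst inverse_mult_eq_1') (simp_all add: power2_eq_square)
  define D where "D = translate (-2) L1 - translate 2 L1"
  have D: "(1 + fps_X) * (1 - fps_X)\<^sup>2 * D
     = 2 * I * fps_X\<^sup>2 * (1 - fps_X) * chi_explicit + 2 * (1 + fps_X) * fps_X\<^sup>2"
    using R_difference unfolding R_def chi D_def .
  have "(1 + fps_X) * (1 - fps_X)\<^sup>2 * D = (1 + fps_X) * (1 - fps_X)\<^sup>2 * (2 * (I * \<psi> + \<eta>))"
    using D psi eta by algebra
  then have "D = 2 * (I * \<psi> + \<eta>)"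
    by (rule fps_eq_if_mult_unit_eq[rotated]) (simp add: power2_eq_square)
  then show thesis
    using psi by (intro that) (simp_all only: D_def \<eta>_def)
qed

lemma w_coef_eq: "w_coef m = (sinh2 * Abs_fps (\<lambda>n. im (Phi $ n))) $ (2 * m + 2)"
  by (simp add: w_coef_def W_series_def fps_div_fps_X_power_nth)

lemma Phi_eq: "Phi = fps_X * borel L1"
  by (rule fps_ext) (simp add: Phi_def borel_def g_coef_eq)

lemma fps_exp_diff_nth: "(fps_exp 2 - fps_exp (-2)) $ n = (of_int (2 ^ n - (-2) ^ n) / fact n :: 'a :: field_char_0)"
  by (simp add: diff_divide_distrib)

text \<open>
  The Borel transform of the difference equation, read off at an odd power of \<open>t\<close>. Only the \<open>\<chi>\<close>-part
  is imaginary; the term \<open>1/(Z-1)^2\<close> has integer coefficients and yields the \<open>e^t\<close> in the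
  definition of \<open>W\<close>.
\<close>

lemma w_coef_value:
  obtains z :: int where "odd z" "w_coef m = of_int z / of_nat (fact (2 * m) * fact (2 * m + 1))"
proof -
  obtain \<psi> where psi: "(1 - fps_X\<^sup>2) * \<psi> = fps_X\<^sup>2 * chi_explicit"
    and diff: "translate (-2) L1 - translate 2 L1
      = 2 * (fps_const ii * \<psi> + fps_X\<^sup>2 * inverse ((1 - fps_X)\<^sup>2))"
    by (rule L1_difference)
  define \<eta> where "\<eta> = fps_X\<^sup>2 * inverse ((1 - fps_X)\<^sup>2 :: gauss_rat fps)"
  define E :: "gauss_rat fps" where "E = fps_exp 2 - fps_exp (-2)"
  have "borel (translate (-2) L1 - translate 2 L1) = E * borel L1"
    unfolding borel_diff borel_translate E_def by (simp add: algebra_simps)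
  then have EB: "E * borel L1 = 2 * (fps_const ii * borel \<psi> + borel \<eta>)"
    unfolding diff \<eta>_def[symmetric] numeral_fps_const borel_cmult borel_add by simp
  have E_nth: "im (E $ n) = 0" "sinh2 $ n = re (E $ n) / 2" for n
  proof -
    have "of_nat (fact n) * E $ n = of_int (2 ^ n - (-2) ^ n)"
      unfolding E_def fps_exp_diff_nth by simp
    from re_im_of_int_quotient[OF this] show "im (E $ n) = 0" "sinh2 $ n = re (E $ n) / 2"
      using fps_exp_diff_nth[of n, where 'a = rat] by (simp_all add: sinh2_def)
  qed
  have eta_nth: "im (\<eta> $ n) = 0" for n
  proof -
    have "inverse ((1 - fps_X)\<^sup>2 :: gauss_rat fps) = Abs_fps (\<lambda>k. of_nat ((2 + k - 1) choose k))"
      using one_minus_const_fps_X_neg_power'[of 2 "1 :: gauss_rat"] by simp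
    then show ?thesis
      by (simp add: \<eta>_def fps_X_power_mult_nth)
  qed
  have "w_coef m = (\<Sum>i=0..2*m+2. sinh2 $ i * im (Phi $ (2 * m + 2 - i)))"
    by (simp add: w_coef_eq fps_mult_nth)
  also have "\<dots> = im ((E * Phi) $ (2 * m + 2)) / 2"
    unfolding fps_mult_nth re_im_sum sum_divide_distrib
    by (intro sum.cong refl) (simp add: re_im_mult_real E_nth)
  also have "(E * Phi) $ (2 * m + 2) = (E * borel L1) $ (2 * m + 1)"
    unfolding Phi_eq mult.left_commute[of E] by simp
  also have "im \<dots> / 2 = re (borel \<psi> $ (2 * m + 1)) + im (borel \<eta> $ (2 * m + 1))"
    unfolding EB numeral_fps_const by (simp add: re_im_mult_real im_ii_mult)
  also have "im (borel \<eta> $ (2 * m + 1)) = 0"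
  proof -
    have "of_nat (fact (2 * m + 1)) * borel \<eta> $ (2 * m + 1) = \<eta> $ (2 * m + 2)"
      by (simp add: borel_def del: fact_Suc)
    then have "of_nat (fact (2 * m + 1)) * im (borel \<eta> $ (2 * m + 1)) = 0"
      using eta_nth[of "2 * m + 2"] by (metis re_im_mult_real(2) re_im_of_nat)
    then show ?thesis by (simp del: fact_Suc)
  qed
  finally have w: "w_coef m = re (borel \<psi> $ (2 * m + 1))" by simp
  have psi_nth: "\<psi> $ (2 * m + 2) = (\<Sum>j\<le>m. chi_explicit $ (2 * j))"
  proof -
    have step: "\<psi> $ n = (if n < 2 then 0 else \<psi> $ (n - 2) + chi_explicit $ (n - 2))" for n
    proof -
      have "\<psi> $ n = ((1 - fps_X\<^sup>2) * \<psi>) $ n + (fps_X\<^sup>2 * \<psi>) $ n"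
        by (simp add: algebra_simps)
      then show ?thesis unfolding psi by (simp add: fps_X_power_mult_nth)
    qed
    have "\<psi> $ (2 * n + 2) = (\<Sum>j\<le>n. chi_explicit $ (2 * j))" for n
    proof (induction n)
      case 0
      then show ?case using step[of 2] step[of 0] by (simp add: numeral_2_eq_2)
    next
      case (Suc n)
      then show ?case using step[of "2 * Suc n + 2"] by simp
    qed
    then show ?thesis .
  qed
  have "\<exists>z. \<forall>j. odd (z j) \<and> fact (2 * j) * chi_explicit $ (2 * j) = (of_int (z j) :: gauss_rat)"
    using chi_explicit_nth by metis
  then obtain z where z: "\<And>j. odd (z j)" "\<And>j. fact (2 * j) * chi_explicit $ (2 * j) = (of_int (z j) :: gauss_rat)"
    by blast
  define d :: "nat \<Rightarrow> nat" where "d j = fact (2 * m) div fact (2 * j)" for j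
  have d: "(fact (2 * m) :: nat) = d j * fact (2 * j)" if "j \<le> m" for j
    unfolding d_def using that by (simp add: fact_dvd)
  define y where "y = (\<Sum>j\<le>m. int (d j) * z j)"
  have "fact (2 * m) * \<psi> $ (2 * m + 2) = of_int y"
  proof -
    have "fact (2 * m) * chi_explicit $ (2 * j) = (of_int (int (d j) * z j) :: gauss_rat)" if "j \<le> m" for j
    proof -
      have "(fact (2 * m) :: gauss_rat) = of_nat (d j) * fact (2 * j)"
        by (metis d[OF that] of_nat_fact of_nat_mult)
      then show ?thesis by (simp add: mult.assoc z(2))
    qed
    then show ?thesis
      unfolding psi_nth sum_distrib_left y_def of_int_sum by (intro sum.cong) auto
  qed
  moreover have "borel \<psi> $ (2 * m + 1) = \<psi> $ (2 * m + 2) / fact (2 * m + 1)"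
    by (simp add: borel_def del: fact_Suc)
  ultimately have "of_nat (fact (2 * m) * fact (2 * m + 1)) * borel \<psi> $ (2 * m + 1) = of_int y"
    by (simp add: mult.assoc del: fact_Suc)
  from re_im_of_int_quotient(2)[OF this] have "w_coef m = of_int y / of_nat (fact (2 * m) * fact (2 * m + 1))"
    by (simp add: w)
  moreover have "odd y"
  proof -
    have "y = (\<Sum>j<m. int (d j) * z j) + int (d m) * z m"
      by (simp add: y_def lessThan_Suc_atMost[symmetric])
    moreover have "even (d j)" if "j < m" for j
      unfolding d_def using that by (rule even_fact_double_div)
    then have "even (\<Sum>j<m. int (d j) * z j)"
      by (intro dvd_sum) auto
    moreover have "odd (int (d m) * z m)"
      using z(1)[of m] by (simp add: d_def)
    ultimately show ?thesis by simp
  qed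
  ultimately show thesis by (rule that[rotated])
qed

section \<open>The theorem\<close>

lemma odd_frac_w_coef: "odd_frac ((fact (2 * m))\<^sup>2 * w_coef m)"
proof -
  obtain z :: int where z: "odd z" "w_coef m = of_int z / of_nat (fact (2 * m) * fact (2 * m + 1))"
    by (rule w_coef_value)
  have f: "(fact (2 * m + 1) :: rat) = of_int (2 * int m + 1) * fact (2 * m)"
    by simp
  have "(fact (2 * m))\<^sup>2 * w_coef m = of_int z / of_int (2 * int m + 1)"
    unfolding z(2) of_nat_mult of_nat_fact f by (simp add: power2_eq_square field_simps del: of_int_add of_int_mult)
  then show ?thesis
    using odd_fracI[OF z(1), of "2 * int m + 1"] by simp
qed

lemma sum_odd_terms:
  fixes f :: "nat \<Rightarrow> 'a::comm_monoid_add"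
  assumes "\<And>i. even i \<Longrightarrow> f i = 0"
  shows "(\<Sum>i\<le>2*m+2. f i) = (\<Sum>k\<le>m. f (2 * k + 1))"
proof (induction m)
  case 0
  show ?case using assms[of 0] assms[of 2] by (simp add: numeral_2_eq_2)
next
  case (Suc m)
  have "(\<Sum>i\<le>2 * Suc m + 2. f i) = (\<Sum>i\<le>2*m+2. f i) + f (2 * m + 3) + f (2 * m + 4)"
    by (simp add: numeral_eq_Suc)
  also note Suc.IH
  also have "f (2 * m + 4) = 0" by (rule assms) simp
  finally show ?case by (simp add: numeral_3_eq_3)
qed

lemma w_coef_convolution:
  "w_coef m = (\<Sum>k\<le>m. 2 ^ (2 * k + 1) / fact (2 * k + 1)
      * (im (g_coef (2 * (m - k) + 1)) / fact (2 * (m - k))))"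
proof -
  have sinh: "sinh2 $ n = (if even n then 0 else 2 ^ n / fact n)" for n
    by (simp add: sinh2_def diff_divide_distrib[symmetric])
  have div: "im (x / fact n) = im x / fact n" for x n
  proof -
    have "fact n * (x / fact n) = x" by simp
    then have "im (of_nat (fact n) * (x / fact n)) = im x" by simp
    then have "fact n * im (x / fact n) = im x"
      unfolding re_im_mult_real(2)[OF re_im_of_nat(2)] re_im_of_nat(1) by simp
    then show ?thesis by (simp add: field_simps)
  qed
  have "w_coef m = (\<Sum>i\<le>2*m+2. sinh2 $ i * im (Phi $ (2 * m + 2 - i)))"
    by (simp add: w_coef_eq fps_mult_nth atLeast0AtMost)
  also have "\<dots> = (\<Sum>k\<le>m. sinh2 $ (2 * k + 1) * im (Phi $ (2 * m + 2 - (2 * k + 1))))"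
    by (rule sum_odd_terms) (simp add: sinh)
  also have "\<dots> = (\<Sum>k\<le>m. 2 ^ (2 * k + 1) / fact (2 * k + 1)
      * (im (g_coef (2 * (m - k) + 1)) / fact (2 * (m - k))))"
  proof (intro sum.cong refl)
    fix k assume "k \<in> {..m}"
    then have "2 * m + 2 - (2 * k + 1) = Suc (2 * (m - k))" by auto
    then show "sinh2 $ (2 * k + 1) * im (Phi $ (2 * m + 2 - (2 * k + 1))) = 2 ^ (2 * k + 1) / fact (2 * k + 1)
      * (im (g_coef (2 * (m - k) + 1)) / fact (2 * (m - k)))"
      by (simp add: sinh Phi_def div del: fact_Suc)
  qed
  finally show ?thesis .
qed

text \<open>
  The normalisation comes from \<open>(2m)!^2\<close> times the coefficient \<open>2 Im g_(2m+1) / (2m)!\<close> of the series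
  \<open>2 Im \<Phi>(t)/t\<close>, whose product with \<open>sinh(2t)/(2t)\<close> is \<open>W\<close>.
\<close>

definition scaled_im_g :: "nat \<Rightarrow> rat" where
  "scaled_im_g m = 2 * fact (2 * m) * im (g_coef (2 * m + 1))"

text \<open>
  The weight is \<open>4^k\<close> times \<open>binomial (2m+1) (2k+1)\<close> times the integer \<open>(2m)!/(2m-2k)!\<close>, divided
  by \<open>2m + 1\<close>.
\<close>

lemma even_frac_convolution_weight:
  assumes "0 < k" "k \<le> m"
  shows "even_frac (4 ^ k / fact (2 * k + 1) * ((fact (2 * m))\<^sup>2 / (fact (2 * (m - k)))\<^sup>2))"
proof -
  define d :: nat where "d = fact (2 * m) div fact (2 * (m - k))"
  have "fact (2 * (m - k)) dvd (fact (2 * m) :: nat)"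
    by (rule fact_dvd) simp
  then have "(fact (2 * m) :: nat) = d * fact (2 * (m - k))"
    by (simp add: d_def)
  then have "(fact (2 * m) :: rat) = of_nat d * fact (2 * (m - k))"
    by (metis of_nat_fact of_nat_mult)
  then have d: "(of_nat d :: rat) = fact (2 * m) / fact (2 * (m - k))"
    by simp
  define c where "c = (2 * m + 1) choose (2 * k + 1)"
  have "of_nat c = (fact (2 * m + 1) / (fact (2 * k + 1) * fact (2 * m + 1 - (2 * k + 1))) :: rat)"
    unfolding c_def by (rule binomial_fact) (use assms in simp)
  also have "2 * m + 1 - (2 * k + 1) = 2 * (m - k)" using assms by simp
  also have "(fact (2 * m + 1) :: rat) = of_int (2 * int m + 1) * fact (2 * m)"
    by simp
  finally have c: "of_nat c = (of_int (2 * int m + 1) * fact (2 * m) / (fact (2 * k + 1) * fact (2 * (m - k))) :: rat)" .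
  have nz: "(of_int (2 * int m + 1) :: rat) \<noteq> 0"
    by (rule odd_imp_nonzero_of_int) simp
  have "a / h * (F\<^sup>2 / f\<^sup>2) = a * (u * F / (h * f) * (F / f)) / u" if "u \<noteq> 0" for a h f F u :: rat
    using that by (simp add: power2_eq_square)
  from this[OF nz, of "4 ^ k"]
  have "4 ^ k / fact (2 * k + 1) * ((fact (2 * m))\<^sup>2 / (fact (2 * (m - k)))\<^sup>2)
      = (4 ^ k * (of_nat c * of_nat d) / of_int (2 * int m + 1) :: rat)"
    unfolding c d .
  also have "\<dots> = of_int (4 ^ k * (int c * int d)) / of_int (2 * int m + 1)"
    by simp
  finally show ?thesis
    unfolding even_frac_def using assms by (intro exI[of _ "4 ^ k * (int c * int d)"] exI[of _ "2 * int m + 1"]) auto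
qed

text \<open>
  The summand \<open>k = 0\<close> of the convolution is \<open>scaled_im_g m\<close> itself, and all other summands are even by
  induction.
\<close>

lemma odd_frac_scaled_im_g: "odd_frac (scaled_im_g m)"
proof (induction m rule: less_induct)
  case (less m)
  let ?c = "\<lambda>k. 4 ^ k / fact (2 * k + 1) * ((fact (2 * m))\<^sup>2 / (fact (2 * (m - k)))\<^sup>2 :: rat)"
  have pow: "2 ^ (2 * k + 1) = (2 * 4 ^ k :: rat)" for k
    by (simp add: power_mult)
  have "(fact (2 * m))\<^sup>2 * w_coef m = (\<Sum>k\<le>m. ?c k * scaled_im_g (m - k))"
    unfolding w_coef_convolution sum_distrib_left scaled_im_g_def pow
    by (intro sum.cong refl) (simp add: field_simps power2_eq_square del: fact_Suc)
  also have "\<dots> = (\<Sum>k\<in>{0<..m}. ?c k * scaled_im_g (m - k)) + scaled_im_g m"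
  proof -
    have "{..m} = insert 0 {0<..m}" by auto
    then show ?thesis by simp
  qed
  finally have "scaled_im_g m = (fact (2 * m))\<^sup>2 * w_coef m - (\<Sum>k\<in>{0<..m}. ?c k * scaled_im_g (m - k))"
    by simp
  moreover have "even_frac (\<Sum>k\<in>{0<..m}. ?c k * scaled_im_g (m - k))"
    by (intro even_frac_sum even_frac_mult even_frac_convolution_weight less.IH) auto
  ultimately show ?case
    using odd_frac_diff[OF odd_frac_w_coef] by simp
qed

theorem theorem12p1:
  shows "(\<forall>m. (fact (2 * m))\<^sup>2 * w_coef m \<in> units2) \<and>
    (\<forall>r\<ge>1. coeff (coeff (kappa r) 1) 0 \<noteq> 0 \<and>
       val2 (coeff (coeff (kappa r) 1) 0) =
         - (3 * int r - 1 + val2 (fact (r - 1))))"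
proof (intro conjI allI impI)
  show "(fact (2 * m))\<^sup>2 * w_coef m \<in> units2" for m
    using odd_frac_val2[OF odd_frac_w_coef[of m]] by (simp add: units2_def)
next
  fix r :: nat assume "1 \<le> r"
  then obtain m where r: "r = Suc m" by (cases r) auto
  define \<kappa> where "\<kappa> = coeff (coeff (kappa r) 1) 0"
  have "\<kappa> = im (g_coef (2 * m + 1)) / 2 ^ (2 * m + 1)"
    unfolding \<kappa>_def coeff10_kappa by (simp add: r)
  then have scaled: "scaled_im_g m = \<kappa> * (2 ^ (2 * m + 2) * fact (2 * m))"
    by (simp add: scaled_im_g_def)
  have unit: "scaled_im_g m \<noteq> 0" "val2 (scaled_im_g m) = 0"
    using odd_frac_val2[OF odd_frac_scaled_im_g] by auto
  then have \<kappa>: "\<kappa> \<noteq> 0" by (auto simp: scaled)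
  have "val2 (scaled_im_g m) = val2 \<kappa> + (int (2 * m + 2) + (int m + val2 (fact m)))"
    unfolding scaled using \<kappa> by (simp add: val2_mult val2_fact_double val2_2_power del: power_Suc power_add of_nat_add)
  with unit(2) \<kappa> show "coeff (coeff (kappa r) 1) 0 \<noteq> 0"
    and "val2 (coeff (coeff (kappa r) 1) 0) = - (3 * int r - 1 + val2 (fact (r - 1)))"
    unfolding \<kappa>_def[symmetric] by (simp_all add: r)
qed

end
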